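(* Let $\mathbb{B}$ be a complete Boolean algebra, $X$ a non-empty set and $\{q_x:x\in X\}\subset\mathbb{B}$. Let $\tau=\{\langle\check{x},q_x\rangle:x\in X\}$ and $F=\bigcup_{x\in X}q_x\uparrow$. Then: (1) If $x\ne y$ implies $q_x\neq q_y$ for all $x,y\in X$, then the following conditions are equivalent: (a) $q_x$ and $q_y$ are incomparable for all different $x,y\in X$; (b) for all $x,y\in X$, if $x\neq y$ then $\|\check{x}\in\tau\not\ni\check{y}\|>0$; (c) $\{q_x:x\in X\}=\mathrm{Min}(F)$. (2) The following conditions are equivalent: (a) $F$ is closed in the space $\langle\mathbb{B},\mathcal{O}^\uparrow\rangle$; (b) $u(F)=F$; (c) for every $f:\omega\to X$ there is $x\in X$ such that $q_x\le\limsup\langle q_{f(n)}:n\in\omega\rangle$; (d) for every finite-to-one $f:\omega\to X$ there is $x\in X$ such that $q_x\le\limsup\langle q_{f(n)}:n\in\omega\rangle$; (e) for every $A\in[X]^\omega$ there is $x\in X$ such that $1\Vdash\ \check{x}\in\tau\Rightarrow|\tau\cap\check{A}|=\check{\omega}$.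
   Context: For a complete Boolean algebra $\mathbb{B}$ and a sequence $x=\langle x_n:n\in\omega\rangle$ in $\mathbb{B}$, $\limsup x=\bigwedge_{k\in\omega}\bigvee_{n\ge k}x_n$. For $b\in\mathbb{B}$, $b\uparrow=\{c\in\mathbb{B}: b\le c\}$. The topology $\mathcal{O}^\uparrow$ on $\mathbb{B}$ is the topology generated by the convergence $x\mapsto\{\limsup x\}$: a set $O\subset\mathbb{B}$ is open iff for every sequence $x$ in $\mathbb{B}$ with $\limsup x\in O$ there is $n_0\in\omega$ such that $x_n\in O$ for all $n\ge n_0$. For $A\subset\mathbb{B}$, $u(A)=\bigcup_{y\in A^\omega}(\limsup y)\uparrow$. $\mathrm{Min}(F)$ is the set of minimal elements of $F$ in the order of $\mathbb{B}$. $[X]^\omega$ is the set of countably infinite subsets of $X$; $f$ is finite-to-one if each of its fibres is finite. Forcing notation: $V$ is the ground model, $V^{\mathbb{B}}$ is the class of $\mathbb{B}$-names, $\|\varphi\|\in\mathbb{B}$ is the Boolean value of $\varphi$, $b\Vdash\varphi$ iff $b\le\|\varphi\|$, and $\check{A}=\{\langle\check{a},1\rangle:a\in A\}$ is the canonical name of $A\in V$. Thus $\tau$ is a $\mathbb{B}$-name for a subset of $X$ with $\|\check{x}\in\tau\|=q_x$; "$\check{x}\in\tau\not\ni\check{y}$" abbreviates "$\check{x}\in\tau$ and $\check{y}\notin\tau$". *)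

theory Defs
  imports "HOL-Analysis.Analysis"
begin

unbundle lattice_syntax

text \<open>
  A complete Boolean algebra is a type of sort \<open>{boolean_algebra, complete_lattice}\<close>. The library
  class \<open>complete_boolean_algebra\<close> is not used: it includes complete distributivity, which would
  restrict the results to atomic algebras.
\<close>


section \<open>The topology generated by the upper limit\<close>

text \<open>On complete lattices the library's \<^const>\<open>limsup\<close> is \<open>\<Sqinter>k. \<Squnion>n\<ge>k. x n\<close>, see
  \<open>limsup_INF_SUP\<close>; \<open>b\<up>\<close> is \<open>{b..}\<close>.\<close>

definition up_open :: "'b::complete_lattice set \<Rightarrow> bool" where
  "up_open U \<longleftrightarrow> (\<forall>x :: nat \<Rightarrow> 'b. limsup x \<in> U \<longrightarrow> (\<exists>n0. \<forall>n\<ge>n0. x n \<in> U))"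

lemma istopology_up_open: "istopology (up_open :: 'b::complete_lattice set \<Rightarrow> bool)"
proof -
  have "up_open (S \<inter> T)" if S: "up_open S" and T: "up_open T" for S T :: "'b set"
    unfolding up_open_def
  proof (intro allI impI)
    fix x :: "nat \<Rightarrow> 'b" assume "limsup x \<in> S \<inter> T"
    then obtain m n where "\<forall>k\<ge>m. x k \<in> S" "\<forall>k\<ge>n. x k \<in> T"
      using S T unfolding up_open_def by (meson IntE)
    then have "\<forall>k\<ge>max m n. x k \<in> S \<inter> T" by simp
    then show "\<exists>n0. \<forall>k\<ge>n0. x k \<in> S \<inter> T" by (rule exI)
  qed
  moreover have "up_open (\<Union>K)" if "\<forall>S\<in>K. up_open S" for K :: "'b set set"
    unfolding up_open_def
  proof (intro allI impI)
    fix x :: "nat \<Rightarrow> 'b" assume "limsup x \<in> \<Union>K"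
    then obtain S where S: "S \<in> K" "limsup x \<in> S" by (rule UnionE)
    with that obtain n where "\<forall>k\<ge>n. x k \<in> S" unfolding up_open_def by meson
    with S(1) show "\<exists>n0. \<forall>k\<ge>n0. x k \<in> \<Union>K" by (meson UnionI)
  qed
  ultimately show ?thesis unfolding istopology_def by simp
qed

definition up_topology :: "'b::complete_lattice topology" where
  "up_topology = topology up_open"

lemma openin_up_topology: "openin up_topology U \<longleftrightarrow> up_open U"
  unfolding up_topology_def by (simp add: istopology_up_open topology_inverse')

lemma topspace_up_topology: "topspace up_topology = UNIV"
  unfolding topspace_def openin_up_topology by (auto simp: up_open_def)

definition up_limits :: "'b::complete_lattice set \<Rightarrow> 'b set" where
  "up_limits A = (\<Union>y\<in>{y :: nat \<Rightarrow> 'b. range y \<subseteq> A}. {limsup y..})"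

definition minimal_elements :: "'b::order set \<Rightarrow> 'b set" where
  "minimal_elements F = {m \<in> F. \<forall>c\<in>F. c \<le> m \<longrightarrow> c = m}"


section \<open>The ground model\<close>

text \<open>
  Ground model sets are elements of a type with a well-founded, extensional membership relation.
  By Mostowski collapse such a type is a transitive collection of sets, and every set of sets
  \<open>X\<close> lies in one of them, for instance its transitive closure or any larger initial segment of
  the universe. No further closure properties are required of the type.
\<close>

class ground_sets =
  fixes elts :: "'a \<Rightarrow> 'a set"
  assumes inj_elts: "inj elts"
    and wf_elts: "wf {(x, y). x \<in> elts y}"

text \<open>Under this instance \<^typ>\<open>nat\<close> is the von Neumann ordinal \<open>\<omega>\<close>.\<close>

instantiation nat :: ground_sets
begin

definition elts_nat_def: "elts n = {..<n}" for n :: nat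

instance
proof
  show "inj (elts :: nat \<Rightarrow> nat set)" by (auto simp: inj_on_def elts_nat_def)
  have "{(x, y). x \<in> elts y} = {(x, y :: nat). x < y}" by (auto simp: elts_nat_def)
  then show "wf {(x, y :: nat). x \<in> elts y}" by (simp add: wf)
qed

end


section \<open>Boolean names\<close>

text \<open>
  A name is a set of pairs (name, Boolean value). Recursion through arbitrary sets is not possible,
  so the set is presented by an enumeration over an index type \<^typ>\<open>'i\<close>: the names in the type
  \<open>('i, 'b) bname\<close> are those which hereditarily have at most \<open>|'i|\<close> elements. Different
  enumerations of one set give different but interchangeable elements of the type.
\<close>

datatype ('i, 'b) bname = Name "'i \<Rightarrow> (('i, 'b) bname \<times> 'b) option"

fun elems :: "('i, 'b) bname \<Rightarrow> (('i, 'b) bname \<times> 'b) set" where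
  "elems (Name f) = ran f"

lemma wf_bname: "wf {(t, u :: ('i, 'b) bname). t \<in> fst ` elems u}"
proof (rule wfUNIVI)
  fix P :: "('i, 'b) bname \<Rightarrow> bool" and x :: "('i, 'b) bname"
  assume step: "\<forall>x. (\<forall>y. (y, x) \<in> {(t, u :: ('i, 'b) bname). t \<in> fst ` elems u} \<longrightarrow> P y) \<longrightarrow> P x"
  show "P x"
  proof (induction x)
    case (Name f)
    have "P t" if "(t, b) \<in> ran f" for t b
    proof -
      from that obtain i where "f i = Some (t, b)" by (auto simp: ran_def)
      then show ?thesis using Name[of "f i" "(t, b)" t] by (metis fsts.intros option.set_intros rangeI fst_conv)
    qed
    then have "\<forall>y. (y, Name f) \<in> {(t, u :: ('i, 'b) bname). t \<in> fst ` elems u} \<longrightarrow> P y" by auto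
    with step show ?case by blast
  qed
qed

definition name_of :: "(('i, 'b) bname \<times> 'b) set \<Rightarrow> ('i, 'b) bname" where
  "name_of S = (SOME u. elems u = S)"

lemma elems_name_of:
  fixes g :: "'i \<Rightarrow> ('i, 'b) bname \<times> 'b"
  assumes "S \<subseteq> range g"
  shows "elems (name_of S) = S"
proof -
  have "elems (Name (\<lambda>i. if g i \<in> S then Some (g i) else None)) = S"
  proof (intro equalityI subsetI)
    fix p assume "p \<in> S"
    moreover from this obtain i where "p = g i" using assms by blast
    ultimately show "p \<in> elems (Name (\<lambda>i. if g i \<in> S then Some (g i) else None))"
      by (auto simp: ran_def)
  qed (auto simp: ran_def split: if_splits)
  then show ?thesis unfolding name_of_def by (rule someI)
qed

lemma elems_name_of_Inl: "elems (name_of (f ` A)) = f ` A"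
  for f :: "'v \<Rightarrow> ('v + 'w, 'b) bname \<times> 'b"
  by (rule elems_name_of[where g = "case_sum f undefined"])
    (auto intro: range_eqI[where x = "Inl _"])

lemma elems_name_of_Inr: "elems (name_of (f ` A)) = f ` A"
  for f :: "'w \<Rightarrow> ('v + 'w, 'b) bname \<times> 'b"
  by (rule elems_name_of[where g = "case_sum undefined f"])
    (auto intro: range_eqI[where x = "Inr _"])

function check :: "'v::ground_sets \<Rightarrow> ('i, 'b::top) bname" where
  "check v = name_of ((\<lambda>a. (check a, \<top>)) ` elts v)"
  by auto
termination by (relation "{(x, y). x \<in> elts y}") (auto intro: wf_elts)

declare check.simps [simp del]

definition check_set :: "'v::ground_sets set \<Rightarrow> ('i, 'b::top) bname" where
  "check_set A = name_of ((\<lambda>a. (check a, \<top>)) ` A)"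

lemma check_eq_check_set: "check v = check_set (elts v)"
  unfolding check_set_def by (rule check.simps)

definition tau :: "'v::ground_sets set \<Rightarrow> ('v \<Rightarrow> 'b::top) \<Rightarrow> ('i, 'b) bname" where
  "tau X q = name_of ((\<lambda>x. (check x, q x)) ` X)"

text \<open>
  The names used below are of type \<open>('v + nat, 'b) bname\<close>, which has room for
  canonical names of all elements and subsets of \<^typ>\<open>'v\<close> and of \<open>\<omega>\<close>.
\<close>

lemma elems_check [simp]:
  "elems (check v :: ('v + nat, 'b::top) bname) = (\<lambda>a. (check a, \<top>)) ` elts v"
  for v :: "'v::ground_sets"
  by (simp add: check.simps[of v] elems_name_of_Inl)

lemma elems_check_nat [simp]:
  "elems (check n :: ('v + nat, 'b::top) bname) = (\<lambda>m. (check m, \<top>)) ` {..<n}" for n :: nat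
  by (simp add: check.simps[of n] elems_name_of_Inr elts_nat_def)

lemma elems_check_set [simp]:
  "elems (check_set A :: ('v + nat, 'b::top) bname) = (\<lambda>a. (check a, \<top>)) ` A"
  for A :: "'v::ground_sets set"
  by (simp add: check_set_def elems_name_of_Inl)

lemma elems_check_set_nat [simp]:
  "elems (check_set A :: ('v + nat, 'b::top) bname) = (\<lambda>n. (check n, \<top>)) ` A" for A :: "nat set"
  by (simp add: check_set_def elems_name_of_Inr)

lemma elems_tau [simp]:
  "elems (tau X q :: ('v + nat, 'b::top) bname) = (\<lambda>x. (check x, q x)) ` X"
  for X :: "'v::ground_sets set"
  by (simp add: tau_def elems_name_of_Inl)

definition omega_name :: "('v + nat, 'b::top) bname" where
  "omega_name = check_set (UNIV :: nat set)"


section \<open>Boolean values\<close>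

text \<open>
  The Boolean value \<open>\<parallel>\<phi>\<parallel>\<close> of a formula is built by replacing the connectives by the operations of
  the algebra and the quantifiers by infima and suprema over all names; the functions \<open>b_\<dots>\<close> below
  are the Boolean values of the formulas they are named after.
\<close>

definition b_imp :: "'b::boolean_algebra \<Rightarrow> 'b \<Rightarrow> 'b" (infixr "\<rightarrow>\<^sub>b" 60) where
  "a \<rightarrow>\<^sub>b b = - a \<squnion> b"

definition b_iff :: "'b::boolean_algebra \<Rightarrow> 'b \<Rightarrow> 'b" (infixr "\<leftrightarrow>\<^sub>b" 60) where
  "a \<leftrightarrow>\<^sub>b b = (a \<rightarrow>\<^sub>b b) \<sqinter> (b \<rightarrow>\<^sub>b a)"

function b_eq :: "('i, 'b::{boolean_algebra, complete_lattice}) bname \<Rightarrow> ('i, 'b) bname \<Rightarrow> 'b"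
  (infix "=\<^sub>b" 70) where
  "u =\<^sub>b v =
     (\<Sqinter>p\<in>elems u. snd p \<rightarrow>\<^sub>b (\<Squnion>r\<in>elems v. snd r \<sqinter> (fst p =\<^sub>b fst r))) \<sqinter>
     (\<Sqinter>r\<in>elems v. snd r \<rightarrow>\<^sub>b (\<Squnion>p\<in>elems u. snd p \<sqinter> (fst p =\<^sub>b fst r)))"
  by auto

termination
  by (relation "inv_image {(t, u). t \<in> fst ` elems u} fst") (auto intro: wf_bname)

declare b_eq.simps [simp del]

definition b_mem :: "('i, 'b::{boolean_algebra, complete_lattice}) bname \<Rightarrow> ('i, 'b) bname \<Rightarrow> 'b"
  (infix "\<in>\<^sub>b" 70) where
  "u \<in>\<^sub>b v = (\<Squnion>(t, b)\<in>elems v. b \<sqinter> (u =\<^sub>b t))"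

lemma b_eq_sym: "(u =\<^sub>b v) = (v =\<^sub>b u)"
proof (induction u v rule: b_eq.induct)
  case (1 u v)
  have sym: "(fst p =\<^sub>b fst r) = (fst r =\<^sub>b fst p)" if "p \<in> elems u" "r \<in> elems v" for p r
    using 1 that by blast
  have "(\<Squnion>r\<in>elems v. snd r \<sqinter> (fst p =\<^sub>b fst r)) = (\<Squnion>r\<in>elems v. snd r \<sqinter> (fst r =\<^sub>b fst p))"
    if "p \<in> elems u" for p
    by (rule SUP_cong) (simp_all only: sym[OF that])
  moreover have "(\<Squnion>p\<in>elems u. snd p \<sqinter> (fst p =\<^sub>b fst r)) = (\<Squnion>p\<in>elems u. snd p \<sqinter> (fst r =\<^sub>b fst p))"
    if "r \<in> elems v" for r
    by (rule SUP_cong) (simp_all only: sym[OF _ that])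
  ultimately show ?case
    by (subst b_eq.simps, subst (2) b_eq.simps, subst inf_commute)
      (intro arg_cong2[where f = inf] INF_cong; simp)
qed

text \<open>The usual form of the recursion for equality: \<open>u = v\<close> iff \<open>u \<subseteq> v\<close> and \<open>v \<subseteq> u\<close>.\<close>

lemma b_eq_iff_subsets:
  "(u =\<^sub>b v) = (\<Sqinter>(t, b)\<in>elems u. b \<rightarrow>\<^sub>b (t \<in>\<^sub>b v)) \<sqinter> (\<Sqinter>(t, b)\<in>elems v. b \<rightarrow>\<^sub>b (t \<in>\<^sub>b u))"
proof -
  have "(\<Squnion>p\<in>elems u. snd p \<sqinter> (fst p =\<^sub>b t)) = (t \<in>\<^sub>b u)" for t
    unfolding b_mem_def case_prod_unfold by (rule SUP_cong) (simp_all only: b_eq_sym[of t])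
  then show ?thesis
    by (subst b_eq.simps) (simp add: b_mem_def case_prod_unfold)
qed

lemma b_eq_refl: "(u =\<^sub>b u) = \<top>"
proof (induction u rule: wf_induct_rule[OF wf_bname])
  case (1 u)
  have "snd p \<le> (\<Squnion>r\<in>elems u. snd r \<sqinter> (fst p =\<^sub>b fst r))" if p: "p \<in> elems u" for p
  proof -
    have "(fst p =\<^sub>b fst p) = \<top>" using p by (intro 1) auto
    then show ?thesis by (intro SUP_upper2[OF p]) simp
  qed
  then have *: "snd p \<rightarrow>\<^sub>b (\<Squnion>r\<in>elems u. snd r \<sqinter> (fst p =\<^sub>b fst r)) = \<top>" if "p \<in> elems u" for p
    using that unfolding b_imp_def sup_shunt by simp
  have "(\<Squnion>p\<in>elems u. snd p \<sqinter> (fst p =\<^sub>b t)) = (\<Squnion>p\<in>elems u. snd p \<sqinter> (t =\<^sub>b fst p))" for t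
    by (rule SUP_cong) (simp_all only: b_eq_sym[of t])
  with * show ?case by (subst b_eq.simps) simp
qed

lemma b_eq_check:
  fixes x y :: "'v::ground_sets"
  shows "((check x :: ('v + nat, 'b::{boolean_algebra, complete_lattice}) bname) =\<^sub>b check y)
    = (if x = y then \<top> else \<bottom>)"
proof (induction x arbitrary: y rule: wf_induct_rule[OF wf_elts])
  case (1 x)
  have mem: "((check a :: ('v + nat, 'b) bname) \<in>\<^sub>b check y) = (if a \<in> elts y then \<top> else \<bottom>)"
    if "a \<in> elts x" for a
  proof -
    have "((check a :: ('v + nat, 'b) bname) \<in>\<^sub>b check y)
        = (\<Squnion>c\<in>elts y. if a = c then \<top> else \<bottom>)"
      unfolding b_mem_def elems_check using 1 that by (simp add: image_image)
    also have "\<dots> = (if a \<in> elts y then \<top> else \<bottom>)"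
      by (auto intro!: antisym SUP_least intro: SUP_upper2)
    finally show ?thesis .
  qed
  have mem': "((check c :: ('v + nat, 'b) bname) \<in>\<^sub>b check x) = (if c \<in> elts x then \<top> else \<bottom>)" for c
  proof -
    have "((check c :: ('v + nat, 'b) bname) \<in>\<^sub>b check x)
        = (\<Squnion>a\<in>elts x. if a = c then \<top> else \<bottom>)"
      unfolding b_mem_def elems_check image_image prod.case inf_top_left
    proof (rule SUP_cong)
      fix a assume "a \<in> elts x"
      then show "((check c :: ('v + nat, 'b) bname) =\<^sub>b check a) = (if a = c then \<top> else \<bottom>)"
        by (subst b_eq_sym) (simp add: 1)
    qed simp
    also have "\<dots> = (if c \<in> elts x then \<top> else \<bottom>)"
      by (auto intro!: antisym SUP_least intro: SUP_upper2)
    finally show ?thesis .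
  qed
  show ?case
  proof (cases "x = y")
    case False
    then have "elts x \<noteq> elts y" using inj_elts by (auto dest: injD)
    then consider a where "a \<in> elts x" "a \<notin> elts y" | c where "c \<in> elts y" "c \<notin> elts x"
      by blast
    then have "((check x :: ('v + nat, 'b) bname) =\<^sub>b check y) \<le> \<bottom>"
    proof cases
      case 1
      then show ?thesis unfolding b_eq_iff_subsets
        by (intro le_infI1 INF_lower2[of "(check a, \<top>)"]) (auto simp: mem b_imp_def)
    next
      case 2
      then show ?thesis unfolding b_eq_iff_subsets
        by (intro le_infI2 INF_lower2[of "(check c, \<top>)"]) (auto simp: mem' b_imp_def)
    qed
    with False show ?thesis by (simp add: bot_unique)
  qed (simp add: b_eq_refl)
qed

lemma b_mem_tau:
  fixes X :: "'v::ground_sets set"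
    and q :: "'v \<Rightarrow> 'b::{boolean_algebra, complete_lattice}"
  assumes "x \<in> X"
  shows "((check x :: ('v + nat, 'b) bname) \<in>\<^sub>b tau X q) = q x"
proof -
  have "((check x :: ('v + nat, 'b) bname) \<in>\<^sub>b tau X q) = (\<Squnion>y\<in>X. if x = y then q y else \<bottom>)"
    unfolding b_mem_def elems_tau image_image
    by (rule SUP_cong) (simp_all add: b_eq_check)
  also have "\<dots> = q x"
    using assms by (auto intro!: antisym SUP_least intro: SUP_upper2)
  finally show ?thesis .
qed

definition forces :: "'b::order \<Rightarrow> 'b \<Rightarrow> bool" (infix "\<tturnstile>" 50) where
  "p \<tturnstile> \<phi> \<longleftrightarrow> p \<le> \<phi>"

definition b_ex1 ::
  "(('i, 'b) bname \<Rightarrow> 'b::{boolean_algebra, complete_lattice}) \<Rightarrow> 'b" where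
  "b_ex1 \<phi> = (\<Squnion>v. \<phi> v \<sqinter> (\<Sqinter>w. \<phi> w \<rightarrow>\<^sub>b (w =\<^sub>b v)))"

text \<open>\<open>w = {u, v}\<close>\<close>

definition b_is_pair ::
  "('i, 'b::{boolean_algebra, complete_lattice}) bname \<Rightarrow> ('i, 'b) bname \<Rightarrow> ('i, 'b) bname \<Rightarrow> 'b"
  where
  "b_is_pair w u v = (\<Sqinter>z. (z \<in>\<^sub>b w) \<leftrightarrow>\<^sub>b ((z =\<^sub>b u) \<squnion> (z =\<^sub>b v)))"

text \<open>\<open>w = \<langle>u, v\<rangle> = {{u, u}, {u, v}}\<close>\<close>

definition b_is_opair ::
  "('i, 'b::{boolean_algebra, complete_lattice}) bname \<Rightarrow> ('i, 'b) bname \<Rightarrow> ('i, 'b) bname \<Rightarrow> 'b"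
  where
  "b_is_opair w u v = (\<Squnion>c. \<Squnion>d. b_is_pair c u u \<sqinter> b_is_pair d u v \<sqinter> b_is_pair w c d)"

text \<open>\<open>\<langle>u, v\<rangle> \<in> f\<close>\<close>

definition b_opair_mem ::
  "('i, 'b::{boolean_algebra, complete_lattice}) bname \<Rightarrow> ('i, 'b) bname \<Rightarrow> ('i, 'b) bname \<Rightarrow> 'b"
  where
  "b_opair_mem u v f = (\<Squnion>w. b_is_opair w u v \<sqinter> (w \<in>\<^sub>b f))"

text \<open>\<open>s = u \<inter> v\<close>\<close>

definition b_is_inter ::
  "('i, 'b::{boolean_algebra, complete_lattice}) bname \<Rightarrow> ('i, 'b) bname \<Rightarrow> ('i, 'b) bname \<Rightarrow> 'b"
  where
  "b_is_inter s u v = (\<Sqinter>z. (z \<in>\<^sub>b s) \<leftrightarrow>\<^sub>b ((z \<in>\<^sub>b u) \<sqinter> (z \<in>\<^sub>b v)))"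

text \<open>\<open>f\<close> is a bijection from \<open>s\<close> onto \<open>k\<close>, as a set of ordered pairs.\<close>

definition b_bijection ::
  "('i, 'b::{boolean_algebra, complete_lattice}) bname \<Rightarrow> ('i, 'b) bname \<Rightarrow> ('i, 'b) bname \<Rightarrow> 'b"
  where
  "b_bijection f s k =
     (\<Sqinter>w. (w \<in>\<^sub>b f) \<rightarrow>\<^sub>b (\<Squnion>u. \<Squnion>v. (u \<in>\<^sub>b s) \<sqinter> (v \<in>\<^sub>b k) \<sqinter> b_is_opair w u v)) \<sqinter>
     (\<Sqinter>u. (u \<in>\<^sub>b s) \<rightarrow>\<^sub>b b_ex1 (\<lambda>v. (v \<in>\<^sub>b k) \<sqinter> b_opair_mem u v f)) \<sqinter>
     (\<Sqinter>v. (v \<in>\<^sub>b k) \<rightarrow>\<^sub>b b_ex1 (\<lambda>u. (u \<in>\<^sub>b s) \<sqinter> b_opair_mem u v f))"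

text \<open>\<open>|s| = k\<close> for a cardinal \<open>k\<close>.\<close>

definition b_card_eq ::
  "('i, 'b::{boolean_algebra, complete_lattice}) bname \<Rightarrow> ('i, 'b) bname \<Rightarrow> 'b" where
  "b_card_eq s k = (\<Squnion>f. b_bijection f s k)"

text \<open>
  \<open>|u \<inter> v| = k\<close>. The suprema here and in \<^const>\<open>b_card_eq\<close> range over the names of type
  \<open>('i, 'b) bname\<close> rather than over a proper class. For infinite \<^typ>\<open>'i\<close> this is no loss: \<open>u \<inter> v\<close> has
  a name indexed by the elements of \<open>u\<close>, and a relation between \<open>u \<inter> v\<close> and \<open>k\<close> has a name indexed by
  pairs of elements of \<open>u\<close> and \<open>k\<close>, up to equality with Boolean value \<open>\<top>\<close>.
\<close>

definition b_card_inter_eq ::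
  "('i, 'b::{boolean_algebra, complete_lattice}) bname \<Rightarrow> ('i, 'b) bname \<Rightarrow> ('i, 'b) bname \<Rightarrow> 'b"
  where
  "b_card_inter_eq u v k = (\<Squnion>s. b_is_inter s u v \<sqinter> b_card_eq s k)"

end

theory Submission
  imports Defs
begin

text \<open>
  Part (2)(e) rests on the identity \<open>\<parallel>|\<tau> \<inter> A| = \<omega>\<parallel> = limsup \<langle>q (e n)\<rangle>\<close> for an injective enumeration \<open>e\<close>
  of \<open>A\<close>. Below the complement of \<open>\<Squnion>n\<ge>k. q (e n)\<close> the set \<open>\<tau> \<inter> A\<close> is contained in
  \<open>{e 0, \<dots>, e (k - 1)}\<close>, and the pigeonhole principle excludes a bijection with \<open>\<omega>\<close>. Conversely,
  \<open>limsup \<langle>q (e n)\<rangle>\<close> forces that \<open>\<tau> \<inter> A\<close> is infinite, so that mapping \<open>e n\<close> to the number of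
  \<open>m < n\<close> with \<open>e m \<in> \<tau>\<close> is a bijection of \<open>\<tau> \<inter> A\<close> with \<open>\<omega>\<close>; this map has an explicit name.
  The remaining equivalences use that passing to a subsequence, or reordering a finite-to-one
  sequence, changes the upper limit monotonically, and that a value taken infinitely often is below
  the upper limit.
\<close>

section \<open>Equality and ordered pairs of names\<close>

text \<open>
  Boolean values are compared in the style of Kripke--Joyal semantics: \<open>a \<le> b\<close> is proved by showing
  that every condition \<open>p \<le> a\<close> satisfies \<open>p \<le> b\<close>. A condition below a supremum is split into
  conditions below the members by the following rule, which replaces the infinite distributive law.
\<close>

lemma le_SUP_elim:
  fixes p :: "'b::{boolean_algebra, complete_lattice}"
  assumes "p \<le> (\<Squnion>i\<in>I. x i)"
    and "\<And>i r. i \<in> I \<Longrightarrow> r \<le> p \<Longrightarrow> r \<le> x i \<Longrightarrow> r \<le> y"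
  shows "p \<le> y"
proof -
  \<comment> \<open>Moving \<open>p\<close> to the right as a complement gives a bound that does not
    depend on \<open>i\<close>, so it passes to the supremum.\<close>
  have "x i \<le> - p \<squnion> y" if "i \<in> I" for i
    using assms(2)[OF that, of "x i \<sqinter> p"] by (simp add: shunt1)
  then have "(\<Squnion>i\<in>I. x i) \<le> - p \<squnion> y" by (rule SUP_least)
  with assms(1) have "p \<le> - p \<squnion> y" by (rule order_trans)
  then show ?thesis by (simp add: shunt1[symmetric])
qed

lemma le_sup_elim:
  fixes p :: "'b::boolean_algebra"
  assumes "p \<le> a \<squnion> b"
    and "\<And>r. r \<le> p \<Longrightarrow> r \<le> a \<Longrightarrow> r \<le> y" "\<And>r. r \<le> p \<Longrightarrow> r \<le> b \<Longrightarrow> r \<le> y"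
  shows "p \<le> y"
proof -
  have "p = (p \<sqinter> a) \<squnion> (p \<sqinter> b)"
    using assms(1) by (simp add: inf_absorb1 flip: inf_sup_distrib1)
  also have "\<dots> \<le> y" using assms(2,3) by simp
  finally show ?thesis .
qed

lemma le_b_imp_iff: "p \<le> (a \<rightarrow>\<^sub>b b) \<longleftrightarrow> (\<forall>r\<le>p. r \<le> a \<longrightarrow> r \<le> b)"
  unfolding b_imp_def shunt1[symmetric]
  by (metis inf.bounded_iff inf_le1 inf_le2 order_refl order_trans)

lemma le_b_iff_iff: "p \<le> (a \<leftrightarrow>\<^sub>b b) \<longleftrightarrow> (\<forall>r\<le>p. r \<le> a \<longleftrightarrow> r \<le> b)"
  by (auto simp: b_iff_def le_b_imp_iff)

lemma le_b_mem_elim: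
  assumes "p \<le> u \<in>\<^sub>b v"
    and "\<And>t b r. (t, b) \<in> elems v \<Longrightarrow> r \<le> p \<Longrightarrow> r \<le> b \<Longrightarrow> r \<le> u =\<^sub>b t \<Longrightarrow> r \<le> y"
  shows "p \<le> y"
  using assms(1) unfolding b_mem_def
  by (rule le_SUP_elim) (auto intro: assms(2))

lemma le_b_memI: "(t, b) \<in> elems v \<Longrightarrow> p \<le> b \<Longrightarrow> p \<le> u =\<^sub>b t \<Longrightarrow> p \<le> u \<in>\<^sub>b v"
  unfolding b_mem_def by (rule SUP_upper2[where i = "(t, b)"]) auto

lemma le_b_eq_iff:
  "p \<le> u =\<^sub>b v \<longleftrightarrow> (\<forall>(t, b)\<in>elems u. \<forall>r\<le>p. r \<le> b \<longrightarrow> r \<le> t \<in>\<^sub>b v) \<and>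
     (\<forall>(t, b)\<in>elems v. \<forall>r\<le>p. r \<le> b \<longrightarrow> r \<le> t \<in>\<^sub>b u)"
  unfolding b_eq_iff_subsets by (auto simp: le_INF_iff le_b_imp_iff)

lemma le_b_eq_sym: "p \<le> u =\<^sub>b v \<Longrightarrow> p \<le> v =\<^sub>b u"
  by (subst b_eq_sym)

text \<open>Induction on the first name: a member of \<open>u\<close> is matched, below a stronger
  condition, with a member \<open>t'\<close> of \<open>v\<close>, and \<open>t'\<close> with a
  member of \<open>w\<close>; the hypothesis for the member of \<open>u\<close> joins the two
  equalities.\<close>

lemma le_b_eq_trans: "p \<le> u =\<^sub>b v \<Longrightarrow> p \<le> v =\<^sub>b w \<Longrightarrow> p \<le> u =\<^sub>b w"
proof (induction u arbitrary: v w p rule: wf_induct_rule[OF wf_bname])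
  case (1 u)
  note uv = 1(2)[unfolded le_b_eq_iff] and vw = 1(3)[unfolded le_b_eq_iff]
  have IH: "r \<le> t =\<^sub>b t''" if "(t, b) \<in> elems u" "r \<le> t =\<^sub>b t'" "r \<le> t' =\<^sub>b t''" for r t b t' t''
    using 1(1)[OF _ that(2,3)] that(1) by force
  have "r \<le> t \<in>\<^sub>b w" if t: "(t, b) \<in> elems u" and r: "r \<le> p" "r \<le> b" for t b r
  proof -
    have "r \<le> t \<in>\<^sub>b v" using uv t r by blast
    then show ?thesis
    proof (rule le_b_mem_elim)
      fix t' b' r' assume *: "(t', b') \<in> elems v" "r' \<le> r" "r' \<le> b'" "r' \<le> t =\<^sub>b t'"
      then have "r' \<le> t' \<in>\<^sub>b w" using vw r by (blast intro: order_trans)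
      then show "r' \<le> t \<in>\<^sub>b w"
        by (rule le_b_mem_elim) (blast intro: le_b_memI IH[OF t] order_trans[OF _ *(4)])
    qed
  qed
  \<comment> \<open>Here the chain starts in \<open>w\<close> and ends in \<open>u\<close>. The
    induction hypothesis wants the member of \<open>u\<close> on the left, so both equalities are
    reversed before joining them, and the result afterwards.\<close>
  moreover have "r \<le> t \<in>\<^sub>b u" if t: "(t, b) \<in> elems w" and r: "r \<le> p" "r \<le> b" for t b r
  proof -
    have "r \<le> t \<in>\<^sub>b v" using vw t r by blast
    then show ?thesis
    proof (rule le_b_mem_elim)
      fix t' b' r' assume *: "(t', b') \<in> elems v" "r' \<le> r" "r' \<le> b'" "r' \<le> t =\<^sub>b t'"
      then have "r' \<le> t' \<in>\<^sub>b u" using uv r by (blast intro: order_trans)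
      then show "r' \<le> t \<in>\<^sub>b u"
        by (rule le_b_mem_elim)
          (blast intro: le_b_memI le_b_eq_sym[OF IH] le_b_eq_sym order_trans[OF _ *(4)])
    qed
  qed
  ultimately show ?case unfolding le_b_eq_iff by blast
qed

lemma le_b_eq_join: "p \<le> u =\<^sub>b w \<Longrightarrow> p \<le> v =\<^sub>b w \<Longrightarrow> p \<le> u =\<^sub>b v"
  by (blast intro: le_b_eq_trans le_b_eq_sym)

lemma le_b_mem_cong_left: "p \<le> u =\<^sub>b u' \<Longrightarrow> p \<le> u \<in>\<^sub>b v \<Longrightarrow> p \<le> u' \<in>\<^sub>b v"
proof (erule le_b_mem_elim)
  fix t b r assume *: "p \<le> u =\<^sub>b u'" "(t, b) \<in> elems v" "r \<le> p" "r \<le> b" "r \<le> u =\<^sub>b t"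
  then have "r \<le> u' =\<^sub>b t" by (meson le_b_eq_sym[OF order_trans] le_b_eq_trans)
  with *(2,4) show "r \<le> u' \<in>\<^sub>b v" by (rule le_b_memI)
qed

lemma le_b_mem_cong_right: "p \<le> v =\<^sub>b v' \<Longrightarrow> p \<le> u \<in>\<^sub>b v \<Longrightarrow> p \<le> u \<in>\<^sub>b v'"
proof (erule le_b_mem_elim)
  fix t b r assume *: "p \<le> v =\<^sub>b v'" "(t, b) \<in> elems v" "r \<le> p" "r \<le> b" "r \<le> u =\<^sub>b t"
  then have "r \<le> t \<in>\<^sub>b v'" unfolding le_b_eq_iff by blast
  then show "r \<le> u \<in>\<^sub>b v'" using *(5) le_b_eq_sym le_b_mem_cong_left by blast
qed

section \<open>Pairs and Kuratowski ordered pairs\<close>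

lemma le_b_is_pair_iff:
  "p \<le> b_is_pair w u v \<longleftrightarrow> (\<forall>z. \<forall>r\<le>p. r \<le> z \<in>\<^sub>b w \<longleftrightarrow> r \<le> (z =\<^sub>b u) \<squnion> (z =\<^sub>b v))"
  by (simp add: b_is_pair_def le_INF_iff le_b_iff_iff)

lemma le_b_is_pair_elim:
  assumes "p \<le> b_is_pair w u v" "p \<le> z \<in>\<^sub>b w"
    and "\<And>r. r \<le> p \<Longrightarrow> r \<le> z =\<^sub>b u \<Longrightarrow> r \<le> y" "\<And>r. r \<le> p \<Longrightarrow> r \<le> z =\<^sub>b v \<Longrightarrow> r \<le> y"
  shows "p \<le> y"
  using assms le_sup_elim[of p "z =\<^sub>b u" "z =\<^sub>b v" y] unfolding le_b_is_pair_iff by blast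

lemma le_b_is_pair_mem:
  assumes "p \<le> b_is_pair w u v"
  shows "p \<le> u \<in>\<^sub>b w" "p \<le> v \<in>\<^sub>b w"
  using assms unfolding le_b_is_pair_iff by (auto simp: b_eq_refl)

lemma le_sup_b_eq_cong:
  assumes "p \<le> u =\<^sub>b u'" "p \<le> v =\<^sub>b v'" "p \<le> (z =\<^sub>b u) \<squnion> (z =\<^sub>b v)"
  shows "p \<le> (z =\<^sub>b u') \<squnion> (z =\<^sub>b v')"
  using assms(3)
  by (rule le_sup_elim)
    (blast intro: le_supI1 le_supI2 le_b_eq_trans order_trans[OF _ assms(1)] order_trans[OF _ assms(2)])+

lemma le_b_is_pair_cong:
  assumes "p \<le> w =\<^sub>b w'" "p \<le> u =\<^sub>b u'" "p \<le> v =\<^sub>b v'" "p \<le> b_is_pair w u v"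
  shows "p \<le> b_is_pair w' u' v'"
  unfolding le_b_is_pair_iff
proof (intro allI impI)
  fix z r assume r: "r \<le> p"
  have *: "r \<le> w =\<^sub>b w'" "r \<le> u =\<^sub>b u'" "r \<le> v =\<^sub>b v'"
    using assms r by (blast intro: order_trans)+
  have "r \<le> z \<in>\<^sub>b w' \<longleftrightarrow> r \<le> z \<in>\<^sub>b w"
    using le_b_mem_cong_right[OF *(1)] le_b_mem_cong_right[OF le_b_eq_sym[OF *(1)]] by blast
  also have "\<dots> \<longleftrightarrow> r \<le> (z =\<^sub>b u) \<squnion> (z =\<^sub>b v)"
    using assms(4) r unfolding le_b_is_pair_iff by blast
  also have "\<dots> \<longleftrightarrow> r \<le> (z =\<^sub>b u') \<squnion> (z =\<^sub>b v')"
    using le_sup_b_eq_cong[OF *(2,3)] le_sup_b_eq_cong[OF *(2,3)[THEN le_b_eq_sym]] by blast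
  finally show "r \<le> z \<in>\<^sub>b w' \<longleftrightarrow> r \<le> (z =\<^sub>b u') \<squnion> (z =\<^sub>b v')" .
qed

lemma le_b_is_opair_elim:
  assumes "p \<le> b_is_opair w u v"
    and "\<And>c d r. r \<le> p \<Longrightarrow> r \<le> b_is_pair c u u \<Longrightarrow> r \<le> b_is_pair d u v \<Longrightarrow>
      r \<le> b_is_pair w c d \<Longrightarrow> r \<le> y"
  shows "p \<le> y"
  using assms(1) unfolding b_is_opair_def
  by (elim le_SUP_elim) (auto intro: assms(2) order_trans)

lemma le_b_is_opairI:
  "p \<le> b_is_pair c u u \<Longrightarrow> p \<le> b_is_pair d u v \<Longrightarrow> p \<le> b_is_pair w c d \<Longrightarrow> p \<le> b_is_opair w u v"
  unfolding b_is_opair_def by (rule SUP_upper2[OF UNIV_I], rule SUP_upper2[OF UNIV_I]) simp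

lemma le_b_is_opair_cong:
  assumes "p \<le> w =\<^sub>b w'" "p \<le> u =\<^sub>b u'" "p \<le> v =\<^sub>b v'" "p \<le> b_is_opair w u v"
  shows "p \<le> b_is_opair w' u' v'"
  using assms(4)
proof (rule le_b_is_opair_elim)
  fix c d r
  assume r: "r \<le> p" and *: "r \<le> b_is_pair c u u" "r \<le> b_is_pair d u v" "r \<le> b_is_pair w c d"
  have eq: "r \<le> w =\<^sub>b w'" "r \<le> u =\<^sub>b u'" "r \<le> v =\<^sub>b v'"
    using assms r by (blast intro: order_trans)+
  show "r \<le> b_is_opair w' u' v'"
    by (rule le_b_is_opairI[of r c u' d v' w',
        OF le_b_is_pair_cong[OF _ _ _ *(1)] le_b_is_pair_cong[OF _ _ _ *(2)]
        le_b_is_pair_cong[OF _ _ _ *(3)]]) (simp_all add: eq b_eq_refl)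
qed

text \<open>The singleton \<open>c\<close> of \<open>u\<close> is a member of
  \<open>{c', d'}\<close>. If it equals \<open>c'\<close>, then \<open>u\<close> lies in the
  singleton of \<open>u'\<close>; if it equals \<open>d'\<close>, then \<open>u'\<close>, a member
  of \<open>d'\<close>, lies in the singleton of \<open>u\<close>.\<close>

lemma le_b_is_opair_fst:
  assumes "p \<le> b_is_opair w u v" "p \<le> b_is_opair w u' v'"
  shows "p \<le> u =\<^sub>b u'"
  using assms(1)
proof (rule le_b_is_opair_elim)
  fix c d r
  assume r: "r \<le> p" and *: "r \<le> b_is_pair c u u" "r \<le> b_is_pair d u v" "r \<le> b_is_pair w c d"
  have "r \<le> b_is_opair w u' v'" using r assms(2) by (rule order_trans)
  then show "r \<le> u =\<^sub>b u'"
  proof (rule le_b_is_opair_elim)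
    fix c' d' s
    assume s: "s \<le> r" and **: "s \<le> b_is_pair c' u' u'" "s \<le> b_is_pair d' u' v'" "s \<le> b_is_pair w c' d'"
    have ***: "s \<le> b_is_pair c u u" "s \<le> b_is_pair w c d"
      using s * by (blast intro: order_trans)+
    note **(3) le_b_is_pair_mem(1)[OF ***(2)]
    then show "s \<le> u =\<^sub>b u'"
    proof (rule le_b_is_pair_elim)
      fix t assume t: "t \<le> s" "t \<le> c =\<^sub>b c'"
      have "t \<le> u \<in>\<^sub>b c"
        by (rule order_trans[OF t(1) le_b_is_pair_mem(1)[OF ***(1)]])
      then have "t \<le> u \<in>\<^sub>b c'" by (rule le_b_mem_cong_right[OF t(2)])
      with order_trans[OF t(1) **(1)] show "t \<le> u =\<^sub>b u'" by (rule le_b_is_pair_elim)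
    next
      fix t assume t: "t \<le> s" "t \<le> c =\<^sub>b d'"
      have "t \<le> u' \<in>\<^sub>b d'"
        by (rule order_trans[OF t(1) le_b_is_pair_mem(1)[OF **(2)]])
      then have "t \<le> u' \<in>\<^sub>b c" by (rule le_b_mem_cong_right[OF le_b_eq_sym[OF t(2)]])
      with order_trans[OF t(1) ***(1)] show "t \<le> u =\<^sub>b u'"
        by (rule le_b_is_pair_elim) (auto intro: le_b_eq_sym)
    qed
  qed
qed

text \<open>The pair \<open>d\<close> equals \<open>c'\<close> or \<open>d'\<close>, so
  \<open>v\<close> equals \<open>u'\<close> or \<open>v'\<close>. Only the case
  \<open>v = u'\<close> needs a further argument, given by \<open>swap\<close>.\<close>

lemma le_b_is_opair_snd:
  assumes "p \<le> b_is_opair w u v" "p \<le> b_is_opair w u' v'"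
  shows "p \<le> v =\<^sub>b v'"
  using assms(1)
proof (rule le_b_is_opair_elim)
  fix c d r
  assume r: "r \<le> p" and *: "r \<le> b_is_pair c u u" "r \<le> b_is_pair d u v" "r \<le> b_is_pair w c d"
  have "r \<le> b_is_opair w u' v'" using r assms(2) by (rule order_trans)
  then show "r \<le> v =\<^sub>b v'"
  proof (rule le_b_is_opair_elim)
    fix c' d' s
    assume s: "s \<le> r" and **: "s \<le> b_is_pair c' u' u'" "s \<le> b_is_pair d' u' v'" "s \<le> b_is_pair w c' d'"
    have ***: "s \<le> b_is_pair c u u" "s \<le> b_is_pair d u v" "s \<le> b_is_pair w c d"
      using s * by (blast intro: order_trans)+
    have uu': "s \<le> u =\<^sub>b u'" using le_b_is_opair_fst[OF assms] r s by (blast intro: order_trans)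
    \<comment> \<open>Now \<open>u\<close>, \<open>u'\<close> and \<open>v\<close> coincide. As
      \<open>d'\<close> is a member of \<open>{c, d}\<close>, its member \<open>v'\<close> equals
      \<open>u\<close> or \<open>v\<close>, hence \<open>v\<close> either way.\<close>
    have swap: "t \<le> v =\<^sub>b v'" if t: "t \<le> s" and vu': "t \<le> v =\<^sub>b u'" for t
    proof -
      have vu: "t \<le> v =\<^sub>b u" using vu' order_trans[OF t uu'] by (rule le_b_eq_join)
      note order_trans[OF t ***(3)] order_trans[OF t le_b_is_pair_mem(2)[OF **(3)]]
      then show ?thesis
      proof (rule le_b_is_pair_elim)
        fix t' assume t': "t' \<le> t" "t' \<le> d' =\<^sub>b c"
        have "t' \<le> v' \<in>\<^sub>b d'"
          by (rule order_trans[OF order_trans[OF t'(1) t] le_b_is_pair_mem(2)[OF **(2)]])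
        then have "t' \<le> v' \<in>\<^sub>b c" by (rule le_b_mem_cong_right[OF t'(2)])
        with order_trans[OF t'(1) order_trans[OF t ***(1)]] show "t' \<le> v =\<^sub>b v'"
          by (rule le_b_is_pair_elim) (blast intro: le_b_eq_join order_trans[OF order_trans[OF _ t'(1)] vu])+
      next
        fix t' assume t': "t' \<le> t" "t' \<le> d' =\<^sub>b d"
        have "t' \<le> v' \<in>\<^sub>b d'"
          by (rule order_trans[OF order_trans[OF t'(1) t] le_b_is_pair_mem(2)[OF **(2)]])
        then have "t' \<le> v' \<in>\<^sub>b d" by (rule le_b_mem_cong_right[OF t'(2)])
        with order_trans[OF t'(1) order_trans[OF t ***(2)]] show "t' \<le> v =\<^sub>b v'"
          by (rule le_b_is_pair_elim) (blast intro: le_b_eq_join order_trans[OF order_trans[OF _ t'(1)] vu])+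
      qed
    qed
    note **(3) le_b_is_pair_mem(2)[OF ***(3)]
    then show "s \<le> v =\<^sub>b v'"
    proof (rule le_b_is_pair_elim)
      fix t assume t: "t \<le> s" "t \<le> d =\<^sub>b c'"
      have "t \<le> v \<in>\<^sub>b d"
        by (rule order_trans[OF t(1) le_b_is_pair_mem(2)[OF ***(2)]])
      then have "t \<le> v \<in>\<^sub>b c'" by (rule le_b_mem_cong_right[OF t(2)])
      with order_trans[OF t(1) **(1)] show "t \<le> v =\<^sub>b v'"
        by (rule le_b_is_pair_elim) (blast intro: swap order_trans[OF _ t(1)])+
    next
      fix t assume t: "t \<le> s" "t \<le> d =\<^sub>b d'"
      have "t \<le> v \<in>\<^sub>b d"
        by (rule order_trans[OF t(1) le_b_is_pair_mem(2)[OF ***(2)]])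
      then have "t \<le> v \<in>\<^sub>b d'" by (rule le_b_mem_cong_right[OF t(2)])
      with order_trans[OF t(1) **(2)] show "t \<le> v =\<^sub>b v'"
        by (rule le_b_is_pair_elim) (blast intro: swap order_trans[OF _ t(1)])+
    qed
  qed
qed

lemma le_b_opair_mem_elim:
  assumes "p \<le> b_opair_mem u v f"
    and "\<And>w r. r \<le> p \<Longrightarrow> r \<le> b_is_opair w u v \<Longrightarrow> r \<le> w \<in>\<^sub>b f \<Longrightarrow> r \<le> y"
  shows "p \<le> y"
  using assms(1) unfolding b_opair_mem_def by (rule le_SUP_elim) (auto intro: assms(2))

lemma le_b_opair_memI: "p \<le> b_is_opair w u v \<Longrightarrow> p \<le> w \<in>\<^sub>b f \<Longrightarrow> p \<le> b_opair_mem u v f"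
  unfolding b_opair_mem_def by (rule SUP_upper2[OF UNIV_I]) simp

lemma le_b_opair_mem_cong:
  assumes "p \<le> u =\<^sub>b u'" "p \<le> v =\<^sub>b v'" "p \<le> b_opair_mem u v f"
  shows "p \<le> b_opair_mem u' v' f"
  using assms(3)
proof (rule le_b_opair_mem_elim)
  fix w r assume r: "r \<le> p" "r \<le> b_is_opair w u v" "r \<le> w \<in>\<^sub>b f"
  have "r \<le> b_is_opair w u' v'"
    by (rule le_b_is_opair_cong[OF _ _ _ r(2)]) (use assms r in \<open>auto simp: b_eq_refl\<close>)
  then show "r \<le> b_opair_mem u' v' f" using r(3) by (rule le_b_opair_memI)
qed

lemma le_b_ex1I:
  assumes "p \<le> \<phi> v" "\<And>w r. r \<le> p \<Longrightarrow> r \<le> \<phi> w \<Longrightarrow> r \<le> w =\<^sub>b v"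
  shows "p \<le> b_ex1 \<phi>"
  unfolding b_ex1_def
  by (rule SUP_upper2[OF UNIV_I[of v]]) (use assms in \<open>auto simp: le_INF_iff le_b_imp_iff\<close>)

lemma le_b_ex1_elim:
  assumes "p \<le> b_ex1 \<phi>" "\<And>v r. r \<le> p \<Longrightarrow> r \<le> \<phi> v \<Longrightarrow> r \<le> y"
  shows "p \<le> y"
  using assms(1) unfolding b_ex1_def by (rule le_SUP_elim) (auto intro: assms(2))

lemma le_b_ex1_unique:
  assumes "p \<le> b_ex1 \<phi>" "p \<le> \<phi> v" "p \<le> \<phi> w"
  shows "p \<le> v =\<^sub>b w"
  using assms(1) unfolding b_ex1_def
proof (rule le_SUP_elim)
  fix z r assume r: "r \<le> p" "r \<le> \<phi> z \<sqinter> (\<Sqinter>w. \<phi> w \<rightarrow>\<^sub>b (w =\<^sub>b z))"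
  then have "r \<le> v =\<^sub>b z" "r \<le> w =\<^sub>b z"
    using assms(2,3) by (auto simp: le_INF_iff le_b_imp_iff)
  then show "r \<le> v =\<^sub>b w" by (blast intro: le_b_eq_sym le_b_eq_trans)
qed

section \<open>The upper bound for the value of infinitude\<close>

text \<open>Infinite descent: if \<open>check m\<close> and \<open>check n\<close> agree for
  \<open>m < n\<close>, then \<open>check m\<close> is a member of \<open>check n\<close>, hence of
  itself, hence equal to \<open>check k\<close> for some \<open>k < m\<close>.
  \<open>b_eq_check\<close> speaks of elements of \<open>'v\<close>, not of numerals.\<close>

lemma b_eq_check_nat:
  fixes m n :: nat
  shows "((check m :: ('v + nat, 'b::{boolean_algebra, complete_lattice}) bname) =\<^sub>b check n)
    = (if m = n then \<top> else \<bottom>)"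
proof -
  have *: "((check m :: ('v + nat, 'b) bname) =\<^sub>b check n) \<le> \<bottom>" if "m < n" for m n :: nat
    using that
  proof (induction m arbitrary: n rule: less_induct)
    case (less m)
    let ?p = "(check m :: ('v + nat, 'b) bname) =\<^sub>b check n"
    have "?p \<le> (check m :: ('v + nat, 'b) bname) \<in>\<^sub>b check n"
      using less.prems by (intro le_b_memI[of "check m" \<top>]) (auto simp: b_eq_refl)
    then have "?p \<le> (check m :: ('v + nat, 'b) bname) \<in>\<^sub>b check m"
      by (rule le_b_mem_cong_right[OF le_b_eq_sym, OF order_refl])
    then show ?case
    proof (rule le_b_mem_elim)
      fix t b r
      assume "(t, b) \<in> elems (check m :: ('v + nat, 'b) bname)" and r: "r \<le> check m =\<^sub>b t"
      then obtain k where "k < m" "t = check k" by auto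
      then show "r \<le> \<bottom>" using less.IH[of k m] r le_b_eq_sym order_trans by blast
    qed
  qed
  show ?thesis
  proof (cases m n rule: linorder_cases)
    case greater
    then show ?thesis using *[of n m] by (simp add: b_eq_sym[of "check m"] bot_unique)
  qed (use *[of m n] in \<open>simp_all add: b_eq_refl bot_unique\<close>)
qed

lemma le_b_mem_omega_elim:
  fixes u :: "('v + nat, 'b::{boolean_algebra, complete_lattice}) bname"
  assumes "p \<le> u \<in>\<^sub>b omega_name"
    and "\<And>(i :: nat) r. r \<le> p \<Longrightarrow> r \<le> u =\<^sub>b check i \<Longrightarrow> r \<le> y"
  shows "p \<le> y"
  using assms(1) by (rule le_b_mem_elim) (auto simp: omega_name_def intro: assms(2))

lemma b_mem_check_omega:
  "((check i :: ('v + nat, 'b::{boolean_algebra, complete_lattice}) bname) \<in>\<^sub>b omega_name) = \<top>"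
  for i :: nat
  by (rule top_le, rule le_b_memI[of "check i" \<top>]) (auto simp: omega_name_def b_eq_refl)

lemma le_b_mem_check_set_elim:
  fixes A :: "'v::ground_sets set"
    and u :: "('v::ground_sets + nat, 'b::{boolean_algebra, complete_lattice}) bname"
  assumes "p \<le> u \<in>\<^sub>b check_set A"
    and "\<And>a r. a \<in> A \<Longrightarrow> r \<le> p \<Longrightarrow> r \<le> u =\<^sub>b check a \<Longrightarrow> r \<le> y"
  shows "p \<le> y"
  using assms(1) by (rule le_b_mem_elim) (auto intro: assms(2))

lemma le_b_mem_tau_elim:
  fixes X :: "'v::ground_sets set"
    and u :: "('v::ground_sets + nat, 'b::{boolean_algebra, complete_lattice}) bname"
  assumes "p \<le> u \<in>\<^sub>b tau X q"
    and "\<And>x r. x \<in> X \<Longrightarrow> r \<le> p \<Longrightarrow> r \<le> q x \<Longrightarrow> r \<le> u =\<^sub>b check x \<Longrightarrow> r \<le> y"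
  shows "p \<le> y"
  using assms(1) by (rule le_b_mem_elim) (auto intro: assms(2))

text \<open>Read \<open>E n i\<close> as: \<open>n\<close> is assigned to \<open>i\<close>. Every
  \<open>i\<close> gets some \<open>n < k\<close>, and no \<open>n\<close> serves two values of
  \<open>i\<close>; this fails already for \<open>k + 1\<close> values of \<open>i\<close>.\<close>

lemma boolean_pigeonhole:
  fixes E :: "nat \<Rightarrow> nat \<Rightarrow> 'b::{boolean_algebra, complete_lattice}"
  assumes cover: "\<And>i. p \<le> (\<Squnion>n\<in>{..<k}. E n i)"
    and disj: "\<And>n i j. i \<noteq> j \<Longrightarrow> p \<sqinter> E n i \<sqinter> E n j = \<bottom>"
  shows "p = \<bottom>"
proof -
  \<comment> \<open>To refute \<open>r\<close> it is enough to refute the stronger conditions that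
    decide a choice \<open>g\<close> on the first \<open>j\<close> values; each induction step
    splits the cover of \<open>j\<close> and extends \<open>g\<close> there.\<close>
  have choose: "r \<le> \<bottom>"
    if "r \<le> p" "\<And>g r'. r' \<le> r \<Longrightarrow> (\<forall>i<j. g i < k \<and> r' \<le> E (g i) i) \<Longrightarrow> r' \<le> \<bottom>" for j r
    using that
  proof (induction j arbitrary: r)
    case 0
    then show ?case by (meson not_less0 order_refl)
  next
    case (Suc j)
    show ?case
    proof (rule Suc.IH)
      fix g r' assume r': "r' \<le> r" "\<forall>i<j. g i < k \<and> r' \<le> E (g i) i"
      have "r' \<le> (\<Squnion>n\<in>{..<k}. E n j)" using r'(1) Suc.prems(1) cover[of j] by (blast intro: order_trans)
      then show "r' \<le> \<bottom>"
      proof (rule le_SUP_elim)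
        fix n s assume s: "n \<in> {..<k}" "s \<le> r'" "s \<le> E n j"
        then have "\<forall>i<Suc j. (g(j := n)) i < k \<and> s \<le> E ((g(j := n)) i) i"
          using r'(2) by (auto simp: less_Suc_eq intro: order_trans)
        then show "s \<le> \<bottom>" using Suc.prems(2) s(2) r'(1) order_trans by blast
      qed
    qed (rule Suc.prems)
  qed
  have "p \<le> \<bottom>"
  proof (rule choose[where j = "Suc k"])
    fix g r assume r: "r \<le> p" and g: "\<forall>i<Suc k. g i < k \<and> r \<le> E (g i) i"
    then have "g ` {..<Suc k} \<subseteq> {..<k}" by auto
    then have "card (g ` {..<Suc k}) < card {..<Suc k}"
      using card_mono[of "{..<k}" "g ` {..<Suc k}"] by auto
    \<comment> \<open>There are \<open>k + 1\<close> arguments and at most \<open>k\<close> values,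
      so one \<open>n\<close> serves two values of \<open>i\<close>, against disjointness.\<close>
    then obtain i j where ij: "i < Suc k" "j < Suc k" "i \<noteq> j" "g i = g j"
      using pigeonhole[of g "{..<Suc k}"] by (auto simp: inj_on_def)
    then have "r \<le> p \<sqinter> E (g i) i \<sqinter> E (g i) j" using r g by (metis le_inf_iff)
    then show "r \<le> \<bottom>" using disj[OF ij(3)] by simp
  qed simp
  then show ?thesis by (simp add: bot_unique)
qed

lemma b_card_inter_tau_le_limsup:
  fixes e :: "nat \<Rightarrow> 'v::ground_sets"
    and q :: "'v \<Rightarrow> 'b::{boolean_algebra, complete_lattice}"
  assumes "range e \<subseteq> X"
  shows "b_card_inter_eq (tau X q :: ('v + nat, 'b) bname) (check_set (range e)) omega_name
    \<le> limsup (\<lambda>n. q (e n))"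
  unfolding limsup_INF_SUP
proof (rule INF_greatest)
  fix k
  let ?Q = "\<Squnion>n\<in>{k..}. q (e n)"
  have main: "p \<le> ?Q"
    if inter: "p \<le> b_is_inter s (tau X q) (check_set (range e))"
      and bij: "p \<le> b_bijection f s omega_name" for p and s f :: "('v + nat, 'b) bname"
  proof -
    \<comment> \<open>The value of: \<open>e n\<close> lies in \<open>s\<close> and \<open>f\<close>
      sends it to \<open>i\<close>. The pigeonhole principle is applied to it below
      \<open>p \<sqinter> - ?Q\<close>.\<close>
    define E where "E n i = (check (e n) \<in>\<^sub>b s) \<sqinter> b_opair_mem (check (e n)) (check i) f" for n i :: nat
    have inter_mem: "r \<le> z \<in>\<^sub>b tau X q" "r \<le> z \<in>\<^sub>b check_set (range e)"
      if "r \<le> p" "r \<le> z \<in>\<^sub>b s" for r z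
      using inter that unfolding b_is_inter_def by (auto simp: le_INF_iff le_b_iff_iff)
    have fun_ex1: "r \<le> b_ex1 (\<lambda>v. (v \<in>\<^sub>b omega_name) \<sqinter> b_opair_mem u v f)"
      if "r \<le> p" "r \<le> u \<in>\<^sub>b s" for r u
      using bij that unfolding b_bijection_def by (auto simp: le_INF_iff le_b_imp_iff)
    have onto_ex1: "r \<le> b_ex1 (\<lambda>u. (u \<in>\<^sub>b s) \<sqinter> b_opair_mem u v f)"
      if "r \<le> p" "r \<le> v \<in>\<^sub>b omega_name" for r v
      using bij that unfolding b_bijection_def by (auto simp: le_INF_iff le_b_imp_iff)
    have "p \<sqinter> - ?Q = \<bottom>"
    proof (rule boolean_pigeonhole)
      fix i :: nat
      \<comment> \<open>Surjectivity of \<open>f\<close> yields a preimage of \<open>i\<close> in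
        \<open>s\<close>, and \<open>s\<close> is contained in \<open>range e\<close>.\<close>
      have "p \<sqinter> - ?Q \<le> b_ex1 (\<lambda>u. (u \<in>\<^sub>b s) \<sqinter> b_opair_mem u (check i) f)"
        by (rule onto_ex1) (simp_all add: b_mem_check_omega)
      then show "p \<sqinter> - ?Q \<le> (\<Squnion>n\<in>{..<k}. E n i)"
      proof (rule le_b_ex1_elim)
        fix u r
        assume r: "r \<le> p \<sqinter> - ?Q" and u: "r \<le> (u \<in>\<^sub>b s) \<sqinter> b_opair_mem u (check i) f"
        then have "r \<le> u \<in>\<^sub>b check_set (range e)" by (intro inter_mem) auto
        then show "r \<le> (\<Squnion>n\<in>{..<k}. E n i)"
        proof (rule le_b_mem_check_set_elim)
          fix a t assume a: "a \<in> range e" and t: "t \<le> r" "t \<le> u =\<^sub>b check a"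
          then obtain n where n: "a = e n" by blast
          have us: "t \<le> u \<in>\<^sub>b s" "t \<le> b_opair_mem u (check i) f" using t(1) u by auto
          have mem: "t \<le> check (e n) \<in>\<^sub>b s" using t(2) us(1) unfolding n by (rule le_b_mem_cong_left)
          show "t \<le> (\<Squnion>n\<in>{..<k}. E n i)"
          proof (cases "n < k")
            case True
            have "t \<le> b_opair_mem (check (e n)) (check i) f"
              by (rule le_b_opair_mem_cong[OF _ _ us(2)]) (use t(2) n in \<open>auto simp: b_eq_refl\<close>)
            with mem have "t \<le> E n i" unfolding E_def by simp
            with True show ?thesis by (intro SUP_upper2[of n]) auto
          next
            case False
            \<comment> \<open>For \<open>n \<ge> k\<close> membership of \<open>e n\<close> in
              \<open>tau\<close> puts the condition below both \<open>?Q\<close> and its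
              complement.\<close>
            have "t \<le> (check (e n) :: ('v + nat, 'b) bname) \<in>\<^sub>b tau X q" using t(1) r by (intro inter_mem mem) auto
            then have "t \<le> q (e n)" using assms by (subst (asm) b_mem_tau) auto
            also have "\<dots> \<le> ?Q" using False by (intro SUP_upper) auto
            finally have "t \<le> ?Q" .
            moreover have "t \<le> - ?Q" using order_trans[OF t(1) r] by simp
            ultimately have "t \<le> ?Q \<sqinter> - ?Q" by (rule le_infI)
            then have "t \<le> \<bottom>" by simp
            then show ?thesis by (simp add: bot_unique)
          qed
        qed
      qed
    next
      fix n i j :: nat assume "i \<noteq> j"
      let ?r = "p \<sqinter> - ?Q \<sqinter> E n i \<sqinter> E n j"
      have "?r \<le> p" by (simp add: le_infI1)
      have rE: "?r \<le> E n i" "?r \<le> E n j" by (simp_all add: le_infI1)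
      \<comment> \<open>\<open>f\<close> is single-valued at \<open>e n\<close>, so \<open>i\<close>
        and \<open>j\<close> would be forced equal.\<close>
      have "?r \<le> b_ex1 (\<lambda>v. (v \<in>\<^sub>b omega_name) \<sqinter> b_opair_mem (check (e n)) v f)"
        using \<open>?r \<le> p\<close> rE unfolding E_def by (intro fun_ex1) auto
      then have "?r \<le> (check i :: ('v + nat, 'b) bname) =\<^sub>b check j"
        by (rule le_b_ex1_unique) (use rE in \<open>auto simp: E_def b_mem_check_omega\<close>)
      then show "?r = \<bottom>" using \<open>i \<noteq> j\<close> by (simp add: b_eq_check_nat bot_unique)
    qed
    then show ?thesis by (simp add: inf_shunt)
  qed
  show "b_card_inter_eq (tau X q :: ('v + nat, 'b) bname) (check_set (range e)) omega_name \<le> ?Q"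
    unfolding b_card_inter_eq_def
  proof (rule SUP_least)
    fix s :: "('v + nat, 'b) bname"
    let ?p = "b_is_inter s (tau X q) (check_set (range e)) \<sqinter> b_card_eq s omega_name"
    have "?p \<le> b_card_eq s omega_name" by simp
    then show "?p \<le> ?Q" unfolding b_card_eq_def
      by (rule le_SUP_elim) (auto intro: main)
  qed
qed

section \<open>Counting in a Boolean algebra\<close>

text \<open>The Boolean value of: exactly \<open>i\<close> of \<open>x 0, \<dots>, x (n - 1)\<close> hold.\<close>

primrec count_val :: "(nat \<Rightarrow> 'b::boolean_algebra) \<Rightarrow> nat \<Rightarrow> nat \<Rightarrow> 'b" where
  "count_val x 0 i = (if i = 0 then \<top> else \<bottom>)"
| "count_val x (Suc n) i =
     (count_val x n i \<sqinter> - x n) \<squnion> ((case i of 0 \<Rightarrow> \<bottom> | Suc j \<Rightarrow> count_val x n j) \<sqinter> x n)"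

text \<open>The Boolean value of: \<open>n\<close> is the \<open>i\<close>-th index, counted from 0, at which \<open>x\<close> holds.\<close>

definition nth_val :: "(nat \<Rightarrow> 'b::boolean_algebra) \<Rightarrow> nat \<Rightarrow> nat \<Rightarrow> 'b" where
  "nth_val x n i = count_val x n i \<sqinter> x n"

lemma nth_val_le_count_val: "nth_val x n i \<le> count_val x (Suc n) (Suc i)"
  by (simp add: nth_val_def)

lemma count_val_inf_neg_le: "count_val x n i \<sqinter> - x n \<le> count_val x (Suc n) i"
  by simp

text \<open>Each value at \<open>Suc n\<close> is split by \<open>x n\<close>: parts with opposite
  sign of \<open>x n\<close> are disjoint, parts with equal sign are so by induction, the positive
  ones at the predecessors of \<open>i\<close> and \<open>j\<close> or because one is zero.\<close>

lemma count_val_disjoint: "i \<noteq> j \<Longrightarrow> count_val x n i \<sqinter> count_val x n j = \<bottom>"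
proof (induction n arbitrary: i j)
  case (Suc n)
  have *: "((a \<sqinter> - y) \<squnion> (b \<sqinter> y)) \<sqinter> ((a' \<sqinter> - y) \<squnion> (b' \<sqinter> y)) = \<bottom>"
    if "a \<sqinter> a' = \<bottom>" "b \<sqinter> b' = \<bottom>" for a b a' b' y :: 'a
  proof -
    have "(a \<sqinter> - y) \<sqinter> (a' \<sqinter> - y) = \<bottom>" "(b \<sqinter> y) \<sqinter> (b' \<sqinter> y) = \<bottom>"
      using that by (metis inf_assoc inf_commute inf_bot_left)+
    moreover have "(a \<sqinter> - y) \<sqinter> (b' \<sqinter> y) = \<bottom>" "(b \<sqinter> y) \<sqinter> (a' \<sqinter> - y) = \<bottom>"
      by (metis inf_assoc inf_commute inf_compl_bot inf_bot_left)+
    ultimately show ?thesis by (simp add: inf_sup_distrib1 inf_sup_distrib2)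
  qed
  show ?case unfolding count_val.simps
    by (rule *) (use Suc in \<open>auto split: nat.split\<close>)
qed auto

text \<open>Counts never decrease along the sequence. Induction on \<open>n\<close> with
  \<open>i\<close> arbitrary, because the count \<open>i\<close> at \<open>Suc n\<close> may come
  from its predecessor at \<open>n\<close>.\<close>

lemma count_val_antimono: "m \<le> n \<Longrightarrow> i < j \<Longrightarrow> count_val x m j \<sqinter> count_val x n i = \<bottom>"
proof (induction n arbitrary: i rule: dec_induct)
  case base
  then show ?case by (intro count_val_disjoint) simp
next
  case (step n)
  have *: "a \<sqinter> b = \<bottom> \<Longrightarrow> a \<sqinter> (b \<sqinter> y) = \<bottom>" for a b y :: 'a
    by (metis inf_assoc inf_bot_left)
  show ?case using step
    by (auto split: nat.split simp: inf_sup_distrib1 *)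
qed

lemma nth_val_disjoint_left: "i \<noteq> j \<Longrightarrow> p \<le> nth_val x n i \<Longrightarrow> p \<le> nth_val x n j \<Longrightarrow> p \<le> \<bottom>"
  using count_val_disjoint[of i j x n] unfolding nth_val_def by (metis le_inf_iff)

text \<open>If \<open>m < n\<close> and \<open>m\<close> is the \<open>i\<close>-th index, the count
  is \<open>Suc i\<close> at \<open>Suc m\<close>, so it cannot be \<open>i\<close> again at
  \<open>n\<close>.\<close>

lemma nth_val_disjoint_right:
  assumes "m \<noteq> n" "p \<le> nth_val x m i" "p \<le> nth_val x n i"
  shows "p \<le> \<bottom>"
proof -
  have "p \<le> \<bottom>" if "m < n" "p \<le> nth_val x m i" "p \<le> nth_val x n i" for m n
  proof -
    have "p \<le> count_val x (Suc m) (Suc i)" using that(2) nth_val_le_count_val by (rule order_trans)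
    moreover have "p \<le> count_val x n i" using that(3) by (simp add: nth_val_def)
    ultimately show ?thesis using count_val_antimono[of "Suc m" n i "Suc i" x] that(1)
      by (metis Suc_leI le_inf_iff lessI)
  qed
  with assms show ?thesis by (metis linorder_neqE_nat)
qed

text \<open>The counts at \<open>n\<close> have supremum \<open>\<top>\<close>, so wherever
  \<open>x n\<close> holds, the number of earlier indices gives its rank.\<close>

lemma le_SUP_nth_val: "x n \<le> (\<Squnion>i. nth_val x n i)"
  for x :: "nat \<Rightarrow> 'b::{boolean_algebra, complete_lattice}"
proof -
  have top: "\<top> \<le> (\<Squnion>i. count_val x n i)"
  proof (induction n)
    case 0
    show ?case by (rule SUP_upper2[of 0]) auto
  next
    case (Suc n)
    then show ?case
    proof (rule le_SUP_elim)
      fix i r assume r: "r \<le> count_val x n i"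
      \<comment> \<open>Under \<open>x n\<close> the count moves on to \<open>Suc i\<close>; under
        the complement it stays \<open>i\<close>.\<close>
      have "r \<le> x n \<squnion> - x n" by simp
      then show "r \<le> (\<Squnion>i. count_val x (Suc n) i)"
      proof (rule le_sup_elim)
        fix s assume "s \<le> r" "s \<le> x n"
        then have "s \<le> nth_val x n i" using r by (auto simp: nth_val_def)
        then have "s \<le> count_val x (Suc n) (Suc i)" using nth_val_le_count_val by (rule order_trans)
        then show "s \<le> (\<Squnion>i. count_val x (Suc n) i)" by (rule SUP_upper2[OF UNIV_I])
      next
        fix s assume "s \<le> r" "s \<le> - x n"
        then have "s \<le> count_val x n i \<sqinter> - x n" using r by auto
        then have "s \<le> count_val x (Suc n) i" using count_val_inf_neg_le by (rule order_trans)
        then show "s \<le> (\<Squnion>i. count_val x (Suc n) i)" by (rule SUP_upper2[OF UNIV_I])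
      qed
    qed
  qed
  have "x n \<le> (\<Squnion>i. count_val x n i)" by (rule order_trans[OF top_greatest top])
  then show ?thesis
  proof (rule le_SUP_elim)
    fix i r assume "r \<le> x n" "r \<le> count_val x n i"
    then show "r \<le> (\<Squnion>i. nth_val x n i)" by (intro SUP_upper2[OF UNIV_I[of i]]) (simp add: nth_val_def)
  qed
qed

text \<open>If \<open>x\<close> holds at no \<open>n \<ge> m\<close> as the \<open>i\<close>-th index, the count stays \<open>i\<close> forever, against the limsup.\<close>

lemma limsup_inf_count_val_le:
  fixes x :: "nat \<Rightarrow> 'b::{boolean_algebra, complete_lattice}"
  shows "limsup x \<sqinter> count_val x m i \<le> (\<Squnion>n. nth_val x n i)" (is "_ \<le> ?R")
proof -
  \<comment> \<open>The part of the left side outside \<open>?R\<close>; the aim is to show that it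
    is zero.\<close>
  let ?y = "limsup x \<sqinter> count_val x m i \<sqinter> - ?R"
  have neg: "?y \<le> - x n" if "?y \<le> count_val x n i" for n
  proof -
    have "?y \<sqinter> x n \<le> nth_val x n i" using that by (simp add: nth_val_def le_infI1)
    also have "\<dots> \<le> ?R" by (rule SUP_upper) simp
    finally have "?y \<sqinter> x n \<le> ?R" .
    moreover have "?y \<sqinter> x n \<le> - ?R" by (simp add: le_infI1)
    ultimately have "?y \<sqinter> x n \<le> ?R \<sqinter> - ?R" by (rule le_infI)
    then have "?y \<sqinter> x n = \<bottom>" by (simp add: bot_unique)
    then show ?thesis by (simp add: inf_shunt)
  qed
  have count: "?y \<le> count_val x n i" if "m \<le> n" for n
    using that
  proof (induction n rule: dec_induct)
    case base
    show ?case by (simp add: le_infI1)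
  next
    case (step n)
    have "?y \<le> count_val x n i \<sqinter> - x n" using step.IH neg[OF step.IH] by (rule le_infI)
    then show ?case using count_val_inf_neg_le by (rule order_trans)
  qed
  \<comment> \<open>The limsup provides some \<open>n \<ge> m\<close> at which \<open>x\<close>
    holds, while \<open>neg\<close> and \<open>count\<close> exclude all of them.\<close>
  have "?y \<le> limsup x" by (simp add: le_infI1)
  also have "\<dots> \<le> (\<Squnion>n\<in>{m..}. x n)" unfolding limsup_INF_SUP by (rule INF_lower) simp
  finally have "?y \<le> \<bottom>"
  proof (rule le_SUP_elim)
    fix n r assume *: "n \<in> {m..}" "r \<le> ?y" "r \<le> x n"
    have "r \<le> - x n" using *(1) by (intro order_trans[OF *(2) neg[OF count]]) simp
    with * have "r \<le> x n \<sqinter> - x n" by (intro le_infI)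
    then show "r \<le> \<bottom>" by simp
  qed
  then show ?thesis by (simp add: bot_unique inf_shunt)
qed

text \<open>The indices are found one after another: if \<open>n\<close> is the \<open>i\<close>-th
  index, the count at \<open>Suc n\<close> is \<open>Suc i\<close>, and the search for the next one
  starts there.\<close>

lemma limsup_le_SUP_nth_val:
  fixes x :: "nat \<Rightarrow> 'b::{boolean_algebra, complete_lattice}"
  shows "limsup x \<le> (\<Squnion>n. nth_val x n i)"
proof (induction i)
  case 0
  \<comment> \<open>\<open>count_val x 0 0\<close> is \<open>\<top>\<close>, so the whole limsup is
    available at the start.\<close>
  show ?case using limsup_inf_count_val_le[of x 0 0] by simp
next
  case (Suc i)
  then show ?case
  proof (rule le_SUP_elim)
    fix n r assume r: "r \<le> limsup x" "r \<le> nth_val x n i"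
    have "r \<le> limsup x \<sqinter> count_val x (Suc n) (Suc i)"
      by (rule le_infI[OF r(1) order_trans[OF r(2) nth_val_le_count_val]])
    then show "r \<le> (\<Squnion>n. nth_val x n (Suc i))" using limsup_inf_count_val_le by (rule order_trans)
  qed
qed

section \<open>A name for the enumeration\<close>

text \<open>Written as an image of a set of natural numbers, because
  \<open>elems_name_of_Inr\<close> then ensures that the name has exactly these members, whatever
  \<open>'v\<close> is.\<close>

definition pair_name ::
  "('v + nat, 'b::top) bname \<Rightarrow> ('v + nat, 'b) bname \<Rightarrow> ('v + nat, 'b) bname" where
  "pair_name u v = name_of ((\<lambda>k. (if k = 0 then u else v, \<top>)) ` {0, 1::nat})"

lemma elems_pair_name: "elems (pair_name u v) = {(u, \<top>), (v, \<top>)}"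
  unfolding pair_name_def by (subst elems_name_of_Inr) auto

lemma b_is_pair_pair_name: "p \<le> b_is_pair (pair_name u v) u v"
  by (simp add: le_b_is_pair_iff b_mem_def elems_pair_name)

definition opair_name ::
  "('v + nat, 'b::top) bname \<Rightarrow> ('v + nat, 'b) bname \<Rightarrow> ('v + nat, 'b) bname" where
  "opair_name u v = pair_name (pair_name u u) (pair_name u v)"

lemma b_is_opair_opair_name: "p \<le> b_is_opair (opair_name u v) u v"
  unfolding opair_name_def by (rule le_b_is_opairI; rule b_is_pair_pair_name)

text \<open>The name of the bijection that sends the \<open>i\<close>-th member of the generic subset of \<open>range e\<close> to \<open>i\<close>.\<close>

definition enum_name ::
  "(nat \<Rightarrow> 'v::ground_sets) \<Rightarrow> (nat \<Rightarrow> 'b) \<Rightarrow> ('v + nat, 'b::boolean_algebra) bname" where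
  "enum_name e x = name_of (range (\<lambda>k. case prod_decode k of
     (n, i) \<Rightarrow> (opair_name (check (e n)) (check i), nth_val x n i)))"

lemma elems_enum_name:
  "elems (enum_name e x) = {(opair_name (check (e n)) (check i), nth_val x n i) |n i. True}"
proof -
  have "elems (enum_name e x) = range (\<lambda>k. case prod_decode k of
     (n, i) \<Rightarrow> (opair_name (check (e n)) (check i), nth_val x n i))"
    unfolding enum_name_def by (rule elems_name_of_Inr)
  \<comment> \<open>\<open>prod_decode\<close> runs through all pairs, so a set of names indexed by
    pairs fits the countable side of the index type.\<close>
  also have "\<dots> = (\<lambda>(n, i). (opair_name (check (e n)) (check i), nth_val x n i)) ` range prod_decode"
    by (simp only: image_image)
  finally show ?thesis by (auto simp: surj_prod_decode)
qed

lemma le_b_opair_mem_enum_nameI: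
  fixes u v :: "('v::ground_sets + nat, 'b::{boolean_algebra, complete_lattice}) bname"
  assumes "p \<le> nth_val x n i" "p \<le> u =\<^sub>b check (e n)" "p \<le> v =\<^sub>b check i"
  shows "p \<le> b_opair_mem u v (enum_name e x)"
proof (rule le_b_opair_memI)
  show "p \<le> b_is_opair (opair_name (check (e n)) (check i)) u v"
    by (rule le_b_is_opair_cong[OF _ _ _ b_is_opair_opair_name])
      (use assms in \<open>auto simp: b_eq_refl intro: le_b_eq_sym\<close>)
  show "p \<le> opair_name (check (e n)) (check i) \<in>\<^sub>b enum_name e x"
    by (rule le_b_memI[OF _ assms(1)]) (auto simp: elems_enum_name b_eq_refl)
qed

text \<open>A member \<open>w\<close> of the enumeration equals one of the listed pairs, and an
  ordered pair determines both components.\<close>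

lemma le_b_opair_mem_enum_name_elim:
  fixes u v :: "('v::ground_sets + nat, 'b::{boolean_algebra, complete_lattice}) bname"
  assumes "p \<le> b_opair_mem u v (enum_name e x)"
    and "\<And>n i r. r \<le> p \<Longrightarrow> r \<le> nth_val x n i \<Longrightarrow> r \<le> u =\<^sub>b check (e n) \<Longrightarrow> r \<le> v =\<^sub>b check i
      \<Longrightarrow> r \<le> y"
  shows "p \<le> y"
  using assms(1)
proof (rule le_b_opair_mem_elim)
  fix w r assume r: "r \<le> p" "r \<le> b_is_opair w u v" "r \<le> w \<in>\<^sub>b enum_name e x"
  from r(3) show "r \<le> y"
  proof (rule le_b_mem_elim)
    fix t b s
    assume "(t, b) \<in> elems (enum_name e x)" and s: "s \<le> r" "s \<le> b" "s \<le> w =\<^sub>b t"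
    then obtain n i where t: "t = opair_name (check (e n)) (check i)" and b: "b = nth_val x n i"
      by (auto simp: elems_enum_name)
    have *: "s \<le> b_is_opair w (check (e n)) (check i)"
      by (rule le_b_is_opair_cong[OF _ _ _ b_is_opair_opair_name])
        (use s(3) t in \<open>auto simp: b_eq_refl intro: le_b_eq_sym\<close>)
    have **: "s \<le> b_is_opair w u v" using s(1) r(2) by (rule order_trans)
    show "s \<le> y"
      using s r(1) le_b_is_opair_fst[OF ** *] le_b_is_opair_snd[OF ** *]
      by (intro assms(2)[of s n i]) (auto simp: b)
  qed
qed

section \<open>The value of infinitude as an upper limit\<close>

text \<open>Restricting the name to \<open>A\<close> gives the intersection with value
  \<open>\<top>\<close>: by \<open>b_mem_tau\<close> an element \<open>a\<close> of \<open>A\<close>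
  has value \<open>q a\<close> in \<open>tau X q\<close> as in \<open>tau A q\<close>.\<close>

lemma b_is_inter_tau:
  fixes q :: "'v::ground_sets \<Rightarrow> 'b::{boolean_algebra, complete_lattice}"
  assumes "A \<subseteq> X"
  shows "p \<le> b_is_inter (tau A q :: ('v + nat, 'b) bname) (tau X q) (check_set A)"
  unfolding b_is_inter_def le_INF_iff le_b_iff_iff
proof (intro ballI allI impI iffI)
  fix z :: "('v + nat, 'b) bname" and r
  assume "r \<le> z \<in>\<^sub>b tau A q"
  then show "r \<le> (z \<in>\<^sub>b tau X q) \<sqinter> (z \<in>\<^sub>b check_set A)"
  proof (rule le_b_mem_tau_elim)
    fix a s assume *: "a \<in> A" "s \<le> q a" "s \<le> z =\<^sub>b check a"
    have "s \<le> z \<in>\<^sub>b tau X q"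
      by (rule le_b_memI[OF _ *(2,3)]) (use assms *(1) in auto)
    moreover have "s \<le> z \<in>\<^sub>b check_set A"
      by (rule le_b_memI[OF _ top_greatest *(3)]) (use *(1) in auto)
    ultimately show "s \<le> (z \<in>\<^sub>b tau X q) \<sqinter> (z \<in>\<^sub>b check_set A)" by simp
  qed
next
  fix z :: "('v + nat, 'b) bname" and r
  assume r: "r \<le> (z \<in>\<^sub>b tau X q) \<sqinter> (z \<in>\<^sub>b check_set A)"
  then have "r \<le> z \<in>\<^sub>b check_set A" by simp
  then show "r \<le> z \<in>\<^sub>b tau A q"
  proof (rule le_b_mem_check_set_elim)
    fix a s assume a: "a \<in> A" and s: "s \<le> r" "s \<le> z =\<^sub>b check a"
    have "s \<le> z \<in>\<^sub>b tau X q" using order_trans[OF s(1) r] by simp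
    with s(2) have "s \<le> (check a :: ('v + nat, 'b) bname) \<in>\<^sub>b tau X q" by (rule le_b_mem_cong_left)
    then have "s \<le> q a" using assms a by (subst (asm) b_mem_tau) auto
    then show "s \<le> z \<in>\<^sub>b tau A q" using s(2) a by (intro le_b_memI[of "check a" "q a"]) auto
  qed
qed

lemma check_eq_conflict:
  fixes x y :: "'v::ground_sets"
    and u :: "('v::ground_sets + nat, 'b::{boolean_algebra, complete_lattice}) bname"
  assumes "p \<le> u =\<^sub>b check x" "p \<le> u =\<^sub>b check y" "x \<noteq> y"
  shows "p \<le> \<bottom>"
  using le_b_eq_trans[OF le_b_eq_sym[OF assms(1)] assms(2)] assms(3) by (simp add: b_eq_check)

lemma check_nat_eq_conflict:
  fixes m n :: nat and u :: "('v + nat, 'b::{boolean_algebra, complete_lattice}) bname"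
  assumes "p \<le> u =\<^sub>b check m" "p \<le> u =\<^sub>b check n" "m \<noteq> n"
  shows "p \<le> \<bottom>"
  using le_b_eq_trans[OF le_b_eq_sym[OF assms(1)] assms(2)] assms(3) by (simp add: b_eq_check_nat)

text \<open>Only surjectivity onto \<open>\<omega>\<close> draws on the limsup. The members are
  pairs of the right kind by construction, and each element of the domain has a unique rank by
  \<open>le_SUP_nth_val\<close> and \<open>nth_val_disjoint_left\<close>.\<close>

lemma limsup_le_b_bijection:
  fixes e :: "nat \<Rightarrow> 'v::ground_sets"
    and q :: "'v \<Rightarrow> 'b::{boolean_algebra, complete_lattice}"
  assumes "inj e"
  shows "limsup (\<lambda>n. q (e n)) \<le> b_bijection (enum_name e (\<lambda>n. q (e n)))
    (tau (range e) q :: ('v + nat, 'b) bname) omega_name"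
    (is "?L \<le> b_bijection ?f ?s _")
proof -
  let ?x = "\<lambda>n. q (e n)"
  have mem_tau: "p \<le> u \<in>\<^sub>b ?s" if "p \<le> nth_val ?x n i" "p \<le> u =\<^sub>b check (e n)"
    for p u n i
    using that by (intro le_b_memI[of "check (e n)" "q (e n)"]) (auto simp: nth_val_def)
  have mem_omega: "p \<le> v \<in>\<^sub>b omega_name" if "p \<le> v =\<^sub>b check i"
    for p and v :: "('v + nat, 'b) bname" and i :: nat
    using that by (intro le_b_memI[of "check i" \<top>]) (auto simp: omega_name_def)
  have "p \<le> (\<Squnion>u. \<Squnion>v. (u \<in>\<^sub>b ?s) \<sqinter> (v \<in>\<^sub>b omega_name) \<sqinter> b_is_opair w u v)"
    if "p \<le> w \<in>\<^sub>b ?f" for p w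
    using that
  proof (rule le_b_mem_elim)
    fix t b r
    assume "(t, b) \<in> elems ?f" and r: "r \<le> p" "r \<le> b" "r \<le> w =\<^sub>b t"
    then obtain n i where t: "t = opair_name (check (e n)) (check i)" and b: "b = nth_val ?x n i"
      by (auto simp: elems_enum_name)
    have "r \<le> b_is_opair w (check (e n)) (check i)"
      by (rule le_b_is_opair_cong[OF _ _ _ b_is_opair_opair_name])
        (use r(3) t in \<open>auto simp: b_eq_refl intro: le_b_eq_sym\<close>)
    moreover have "r \<le> check (e n) \<in>\<^sub>b ?s"
      by (rule mem_tau) (use r(2) b in \<open>auto simp: b_eq_refl\<close>)
    ultimately show "r \<le> (\<Squnion>u. \<Squnion>v. (u \<in>\<^sub>b ?s) \<sqinter> (v \<in>\<^sub>b omega_name) \<sqinter> b_is_opair w u v)"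
      by (intro SUP_upper2[OF UNIV_I[of "check (e n)"]] SUP_upper2[OF UNIV_I[of "check i"]])
        (simp add: b_mem_check_omega)
  qed
  moreover have "p \<le> b_ex1 (\<lambda>v. (v \<in>\<^sub>b omega_name) \<sqinter> b_opair_mem u v ?f)"
    if "p \<le> u \<in>\<^sub>b ?s" for p u
    using that
  proof (rule le_b_mem_tau_elim)
    fix a r assume "a \<in> range e" and r: "r \<le> q a" "r \<le> u =\<^sub>b check a"
    then obtain n where a: "a = e n" by blast
    have "r \<le> (\<Squnion>i. nth_val ?x n i)" using r(1) le_SUP_nth_val[of ?x n] unfolding a by (rule order_trans)
    then show "r \<le> b_ex1 (\<lambda>v. (v \<in>\<^sub>b omega_name) \<sqinter> b_opair_mem u v ?f)"
    proof (rule le_SUP_elim)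
      fix i s assume s: "s \<le> r" "s \<le> nth_val ?x n i"
      have u: "s \<le> u =\<^sub>b check (e n)" using s(1) r(2) unfolding a by (rule order_trans)
      show "s \<le> b_ex1 (\<lambda>v. (v \<in>\<^sub>b omega_name) \<sqinter> b_opair_mem u v ?f)"
      proof (rule le_b_ex1I)
        show "s \<le> (check i \<in>\<^sub>b omega_name) \<sqinter> b_opair_mem u (check i) ?f"
          using s(2) u by (auto simp: b_mem_check_omega b_eq_refl intro: le_b_opair_mem_enum_nameI)
      next
        fix w t assume t: "t \<le> s" "t \<le> (w \<in>\<^sub>b omega_name) \<sqinter> b_opair_mem u w ?f"
        then have "t \<le> b_opair_mem u w ?f" by simp
        then show "t \<le> w =\<^sub>b check i"
        proof (rule le_b_opair_mem_enum_name_elim)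
          fix m j t'
          assume t': "t' \<le> t" "t' \<le> nth_val ?x m j" "t' \<le> u =\<^sub>b check (e m)" "t' \<le> w =\<^sub>b check j"
          have "t' \<le> s" using t'(1) t(1) by (rule order_trans)
          then have *: "t' \<le> u =\<^sub>b check (e n)" "t' \<le> nth_val ?x n i" using u s(2) by auto
          show "t' \<le> w =\<^sub>b check i"
          \<comment> \<open>If \<open>m \<noteq> n\<close>, injectivity of \<open>e\<close> makes
            the two equations for \<open>u\<close> contradictory; if \<open>m = n\<close>, one index
            would have two ranks \<open>i\<close> and \<open>j\<close>.\<close>
          proof (cases "m = n \<and> i = j")
            case False
            then have "t' \<le> \<bottom>"
              using check_eq_conflict[OF t'(3) *(1)] nth_val_disjoint_left[OF _ t'(2)] *(2) assms
              by (metis injD)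
            then show ?thesis by (simp add: bot_unique)
          qed (use t' in simp)
        qed
      qed
    qed
  qed
  moreover have "p \<le> b_ex1 (\<lambda>u. (u \<in>\<^sub>b ?s) \<sqinter> b_opair_mem u v ?f)"
    if "p \<le> ?L" "p \<le> v \<in>\<^sub>b omega_name" for p v
    using that(2)
  proof (rule le_b_mem_omega_elim)
    fix i :: nat and r assume r: "r \<le> p" "r \<le> v =\<^sub>b check i"
    \<comment> \<open>Below the limsup there are infinitely many indices, hence an
      \<open>i\<close>-th one.\<close>
    have "r \<le> (\<Squnion>n. nth_val ?x n i)"
      using r(1) that(1) limsup_le_SUP_nth_val[of ?x i] by (meson order_trans)
    then show "r \<le> b_ex1 (\<lambda>u. (u \<in>\<^sub>b ?s) \<sqinter> b_opair_mem u v ?f)"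
    proof (rule le_SUP_elim)
      fix n s assume s: "s \<le> r" "s \<le> nth_val ?x n i"
      have v: "s \<le> v =\<^sub>b check i" using s(1) r(2) by (rule order_trans)
      show "s \<le> b_ex1 (\<lambda>u. (u \<in>\<^sub>b ?s) \<sqinter> b_opair_mem u v ?f)"
      proof (rule le_b_ex1I)
        show "s \<le> (check (e n) \<in>\<^sub>b ?s) \<sqinter> b_opair_mem (check (e n)) v ?f"
          using s(2) v
          by (auto simp: b_eq_refl intro: le_b_opair_mem_enum_nameI mem_tau)
      next
        fix w t assume t: "t \<le> s" "t \<le> (w \<in>\<^sub>b ?s) \<sqinter> b_opair_mem w v ?f"
        then have "t \<le> b_opair_mem w v ?f" by simp
        then show "t \<le> w =\<^sub>b check (e n)"
        proof (rule le_b_opair_mem_enum_name_elim)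
          fix m j t'
          assume t': "t' \<le> t" "t' \<le> nth_val ?x m j" "t' \<le> w =\<^sub>b check (e m)" "t' \<le> v =\<^sub>b check j"
          have "t' \<le> s" using t'(1) t(1) by (rule order_trans)
          then have *: "t' \<le> v =\<^sub>b check i" "t' \<le> nth_val ?x n i" using v s(2) by auto
          show "t' \<le> w =\<^sub>b check (e n)"
          \<comment> \<open>Distinct numerals \<open>i\<close> and \<open>j\<close> contradict the
            equations for \<open>v\<close>; the same rank at distinct indices is impossible.\<close>
          proof (cases "m = n \<and> i = j")
            case False
            then have "t' \<le> \<bottom>"
              using check_nat_eq_conflict[OF t'(4) *(1)] nth_val_disjoint_right[OF _ t'(2)] *(2)
              by metis
            then show ?thesis by (simp add: bot_unique)
          qed (use t' in simp)
        qed
      qed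
    qed
  qed
  ultimately show ?thesis
    unfolding b_bijection_def by (auto simp: le_INF_iff le_b_imp_iff)
qed

lemma b_card_inter_tau_eq_limsup:
  fixes e :: "nat \<Rightarrow> 'v::ground_sets"
    and q :: "'v \<Rightarrow> 'b::{boolean_algebra, complete_lattice}"
  assumes "inj e" "range e \<subseteq> X"
  shows "b_card_inter_eq (tau X q :: ('v + nat, 'b) bname) (check_set (range e)) omega_name
    = limsup (\<lambda>n. q (e n))" (is "?B = ?L")
proof (rule antisym)
  show "?B \<le> ?L" using assms(2) by (rule b_card_inter_tau_le_limsup)
  have card: "?L \<le> b_card_eq (tau (range e) q :: ('v + nat, 'b) bname) omega_name"
    unfolding b_card_eq_def by (rule SUP_upper2[OF UNIV_I]) (rule limsup_le_b_bijection[OF assms(1)])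
  show "?L \<le> ?B"
    unfolding b_card_inter_eq_def
    by (rule SUP_upper2[OF UNIV_I]) (rule le_infI[OF b_is_inter_tau[OF assms(2)] card])
qed

section \<open>Upper limits and closed sets\<close>

lemma UN_atLeast_upward: "\<forall>a\<in>(\<Union>x\<in>X. {q x..}). {a..} \<subseteq> (\<Union>x\<in>X. {q x..})"
  for q :: "'v \<Rightarrow> 'b::order"
proof (intro ballI subsetI)
  fix a b assume "a \<in> (\<Union>x\<in>X. {q x..})" "b \<in> {a..}"
  then obtain x where "x \<in> X" "q x \<le> a" "a \<le> b" by auto
  then show "b \<in> (\<Union>x\<in>X. {q x..})" using order_trans[of "q x" a b] by auto
qed

text \<open>Each tail of \<open>x\<close> contains a tail of the composition. Stated for any
  \<open>g\<close> tending to infinity, so that it covers subsequences as well as injective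
  rearrangements.\<close>

lemma limsup_comp_le:
  fixes x :: "nat \<Rightarrow> 'b::complete_lattice"
  assumes "filterlim g sequentially sequentially"
  shows "limsup (\<lambda>n. x (g n)) \<le> limsup x"
  unfolding limsup_INF_SUP
proof (rule INF_greatest)
  fix k
  from assms obtain N where "\<forall>n\<ge>N. k \<le> g n"
    unfolding filterlim_at_top eventually_sequentially by blast
  then show "(\<Sqinter>n. \<Squnion>m\<in>{n..}. x (g m)) \<le> (\<Squnion>m\<in>{k..}. x m)"
    by (intro INF_lower2[of N] SUP_least SUP_upper) auto
qed

lemma limsup_mono_le: "(\<And>n. x n \<le> y n) \<Longrightarrow> limsup x \<le> limsup y"
  for x :: "nat \<Rightarrow> 'b::complete_lattice"
  by (rule Limsup_mono) simp

text \<open>Contraposition of openness of the complement: a sequence not eventually outside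
  \<open>F\<close> is in \<open>F\<close> infinitely often.\<close>

lemma closedin_up_topology_iff:
  "closedin up_topology F \<longleftrightarrow> (\<forall>x. (\<exists>\<^sub>F n in sequentially. x n \<in> F) \<longrightarrow> limsup x \<in> F)"
  by (simp add: closedin_def topspace_up_topology openin_up_topology up_open_def
      frequently_def eventually_sequentially) blast

lemma subset_up_limits: "F \<subseteq> up_limits F"
proof
  fix a assume "a \<in> F"
  moreover have "limsup (\<lambda>n::nat. a) = a" by (simp add: limsup_INF_SUP)
  ultimately show "a \<in> up_limits F"
    unfolding up_limits_def by (intro UN_I[of "\<lambda>n. a"]) auto
qed

lemma up_limits_eq_iff:
  assumes "\<forall>a\<in>F. {a..} \<subseteq> F"
  shows "up_limits F = F \<longleftrightarrow> (\<forall>y. range y \<subseteq> F \<longrightarrow> limsup y \<in> F)"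
proof -
  have "up_limits F \<subseteq> F \<longleftrightarrow> (\<forall>y. range y \<subseteq> F \<longrightarrow> limsup y \<in> F)"
    unfolding up_limits_def using assms by fastforce
  then show ?thesis using subset_up_limits[of F] by blast
qed

text \<open>A sequence that is infinitely often in \<open>F\<close> has a subsequence inside
  \<open>F\<close>, whose limsup is no larger; upward closure carries membership back to the limsup
  of the whole sequence.\<close>

lemma closedin_up_topology_iff_up_limits:
  assumes up: "\<forall>a\<in>F. {a..} \<subseteq> F"
  shows "closedin up_topology F \<longleftrightarrow> up_limits F = F"
  unfolding closedin_up_topology_iff up_limits_eq_iff[OF up]
proof (intro iffI allI impI)
  fix y :: "nat \<Rightarrow> 'a"
  assume "\<forall>x. (\<exists>\<^sub>F n in sequentially. x n \<in> F) \<longrightarrow> limsup x \<in> F" "range y \<subseteq> F"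
  then show "limsup y \<in> F" by (simp add: range_subsetD)
next
  fix x :: "nat \<Rightarrow> 'a"
  assume lim: "\<forall>y. range y \<subseteq> F \<longrightarrow> limsup y \<in> F" and "\<exists>\<^sub>F n in sequentially. x n \<in> F"
  then have inf: "infinite {n. x n \<in> F}"
    by (simp add: frequently_cofinite flip: cofinite_eq_sequentially)
  let ?g = "enumerate {n. x n \<in> F}"
  have "strict_mono ?g" using inf by (rule strict_mono_enumerate)
  then have "limsup (\<lambda>n. x (?g n)) \<le> limsup x"
    by (intro limsup_comp_le filterlim_subseq)
  moreover have "range (\<lambda>n. x (?g n)) \<subseteq> F" using enumerate_in_set[OF inf] by auto
  ultimately show "limsup x \<in> F" using lim up by fastforce
qed

lemma up_limits_eq_iff_limsup:
  assumes F: "F = (\<Union>x\<in>X. {q x..})"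
  shows "up_limits F = F \<longleftrightarrow>
    (\<forall>f. range f \<subseteq> X \<longrightarrow> (\<exists>x\<in>X. q x \<le> limsup (\<lambda>n. q (f n))))"
proof -
  have up: "\<forall>a\<in>F. {a..} \<subseteq> F" unfolding F by (rule UN_atLeast_upward)
  show ?thesis unfolding up_limits_eq_iff[OF up]
  proof (intro iffI allI impI)
    fix f :: "nat \<Rightarrow> _" assume lim: "\<forall>y. range y \<subseteq> F \<longrightarrow> limsup y \<in> F" and "range f \<subseteq> X"
    then have "range (\<lambda>n. q (f n)) \<subseteq> F" using F by auto
    with lim have "limsup (\<lambda>n. q (f n)) \<in> F" by blast
    then show "\<exists>x\<in>X. q x \<le> limsup (\<lambda>n. q (f n))" using F by auto
  next
    fix y :: "nat \<Rightarrow> _"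
    assume lim: "\<forall>f. range f \<subseteq> X \<longrightarrow> (\<exists>x\<in>X. q x \<le> limsup (\<lambda>n. q (f n)))" and "range y \<subseteq> F"
    \<comment> \<open>Replacing each \<open>y n\<close> by a generator below it can only lower the
      limsup.\<close>
    have "\<exists>x. x \<in> X \<and> q x \<le> y n" for n
      using range_subsetD[OF \<open>range y \<subseteq> F\<close>, of n] unfolding F by auto
    then obtain f where f: "\<And>n. f n \<in> X" "\<And>n. q (f n) \<le> y n" by metis
    then obtain x where x: "x \<in> X" "q x \<le> limsup (\<lambda>n. q (f n))" using lim by blast
    have "q x \<le> limsup y" using x(2) limsup_mono_le[OF f(2)] by (rule order_trans)
    with x(1) show "limsup y \<in> F" using F by auto
  qed
qed

section \<open>Finite-to-one sequences and countable subsets\<close>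

lemma infinite_fibre_le_limsup:
  fixes x :: "nat \<Rightarrow> 'b::complete_lattice"
  assumes "infinite {n. x n = a}"
  shows "a \<le> limsup x"
  unfolding limsup_INF_SUP
proof (rule INF_greatest)
  fix k
  obtain n where "n \<ge> k" "x n = a" using assms by (auto simp: infinite_nat_iff_unbounded_le)
  then show "a \<le> (\<Squnion>m\<in>{k..}. x m)" by (intro SUP_upper2[of n]) auto
qed

text \<open>A map with an infinite fibre over \<open>x\<close> satisfies the condition with
  \<open>x\<close> itself, by \<open>infinite_fibre_le_limsup\<close>.\<close>

lemma limsup_iff_finite_to_one:
  "(\<forall>f :: nat \<Rightarrow> 'v. range f \<subseteq> X \<longrightarrow> (\<exists>x\<in>X. q x \<le> limsup (\<lambda>n. q (f n)))) \<longleftrightarrow>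
   (\<forall>f :: nat \<Rightarrow> 'v. range f \<subseteq> X \<and> (\<forall>x\<in>X. finite {n. f n = x}) \<longrightarrow>
      (\<exists>x\<in>X. q x \<le> limsup (\<lambda>n. q (f n))))"
  for q :: "'v \<Rightarrow> 'b::complete_lattice"
proof (intro iffI allI impI)
  fix f :: "nat \<Rightarrow> 'v"
  assume fin: "\<forall>f :: nat \<Rightarrow> 'v. range f \<subseteq> X \<and> (\<forall>x\<in>X. finite {n. f n = x}) \<longrightarrow>
      (\<exists>x\<in>X. q x \<le> limsup (\<lambda>n. q (f n)))" and f: "range f \<subseteq> X"
  show "\<exists>x\<in>X. q x \<le> limsup (\<lambda>n. q (f n))"
  proof (cases "\<forall>x\<in>X. finite {n. f n = x}")
    case False
    then obtain x where x: "x \<in> X" "infinite {n. f n = x}" by blast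
    then have "infinite {n. q (f n) = q x}" by (auto elim!: infinite_super[rotated])
    then show ?thesis using x(1) infinite_fibre_le_limsup[of "\<lambda>n. q (f n)" "q x"] by blast
  qed (use fin f in blast)
qed blast

text \<open>Selecting for each \<open>n\<close> a place \<open>g n\<close> where \<open>f\<close>
  takes the value \<open>e n\<close> gives an injective \<open>g\<close>, which tends to infinity,
  so \<open>limsup_comp_le\<close> applies.\<close>

lemma limsup_reenumerate_le:
  fixes q :: "'v \<Rightarrow> 'b::complete_lattice"
  assumes "inj e" "range e = range f" "\<And>x. x \<in> range f \<Longrightarrow> finite {n. f n = x}"
  shows "limsup (\<lambda>n. q (e n)) \<le> limsup (\<lambda>n. q (f n))"
proof -
  have "\<forall>n. \<exists>m. f m = e n" using assms(2) by (metis rangeE rangeI)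
  then obtain g where g: "\<And>n. f (g n) = e n" by metis
  then have "inj g" using assms(1) by (metis injD injI)
  have "filterlim g sequentially sequentially"
    unfolding filterlim_iff cofinite_eq_sequentially[symmetric] eventually_cofinite
  proof (intro allI impI)
    fix P :: "nat \<Rightarrow> bool" assume "finite {n. \<not> P n}"
    from finite_vimageI[OF this \<open>inj g\<close>] show "finite {n. \<not> P (g n)}" by (simp add: vimage_def)
  qed
  from limsup_comp_le[OF this, of "\<lambda>n. q (f n)"] show ?thesis by (simp add: g)
qed

lemma finite_to_one_limsup_iff_forces:
  fixes X :: "'v::ground_sets set"
    and q :: "'v \<Rightarrow> 'b::{boolean_algebra, complete_lattice}"
  shows "(\<forall>f :: nat \<Rightarrow> 'v. range f \<subseteq> X \<and> (\<forall>x\<in>X. finite {n. f n = x}) \<longrightarrow>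
      (\<exists>x\<in>X. q x \<le> limsup (\<lambda>n. q (f n)))) \<longleftrightarrow>
    (\<forall>A. A \<subseteq> X \<and> infinite A \<and> countable A \<longrightarrow>
      (\<exists>x\<in>X. \<top> \<tturnstile> ((check x :: ('v + nat, 'b) bname) \<in>\<^sub>b tau X q) \<rightarrow>\<^sub>b
        b_card_inter_eq (tau X q :: ('v + nat, 'b) bname) (check_set A) omega_name))"
    (is "?lim \<longleftrightarrow> ?forces")
proof -
  \<comment> \<open>By the identity for the value of infinitude and \<open>b_mem_tau\<close>,
    forcing the implication is an inequality in the algebra: \<open>- a \<squnion> b\<close> is
    \<open>\<top>\<close> exactly when \<open>a \<le> b\<close>.\<close>
  have forces: "\<top> \<tturnstile> ((check x :: ('v + nat, 'b) bname) \<in>\<^sub>b tau X q) \<rightarrow>\<^sub>b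
        b_card_inter_eq (tau X q :: ('v + nat, 'b) bname) (check_set (range e)) omega_name
      \<longleftrightarrow> q x \<le> limsup (\<lambda>n. q (e n))" if "x \<in> X" "inj e" "range e \<subseteq> X" for x e
    unfolding forces_def b_mem_tau[OF that(1)] b_card_inter_tau_eq_limsup[OF that(2,3)]
    by (simp add: b_imp_def top_unique sup_shunt)
  show ?thesis
  proof (intro iffI allI impI)
    fix A assume lim: ?lim and A: "A \<subseteq> X \<and> infinite A \<and> countable A"
    define e where "e = from_nat_into A"
    have e: "inj e" "range e = A"
      using A bij_betw_from_nat_into[of A] unfolding e_def by (auto simp: bij_betw_def)
    have "finite {n. e n = x}" for x
      using finite_vimageI[OF _ e(1), of "{x}"] by (simp add: vimage_def)
    then obtain x where "x \<in> X" "q x \<le> limsup (\<lambda>n. q (e n))" using lim e(2) A by blast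
    then show "\<exists>x\<in>X. \<top> \<tturnstile> ((check x :: ('v + nat, 'b) bname) \<in>\<^sub>b tau X q) \<rightarrow>\<^sub>b
        b_card_inter_eq (tau X q :: ('v + nat, 'b) bname) (check_set A) omega_name"
      using forces[OF _ e(1)] e(2) A by blast
  next
    fix f :: "nat \<Rightarrow> 'v"
    assume ?forces and f: "range f \<subseteq> X \<and> (\<forall>x\<in>X. finite {n. f n = x})"
    \<comment> \<open>A finite range would make \<open>\<omega>\<close> a finite union of finite
      fibres.\<close>
    have "UNIV = (\<Union>x\<in>range f. {n. f n = x})" by auto
    then have inf: "infinite (range f)" using f infinite_UNIV_nat
      by (metis (no_types, lifting) finite_UN subsetD)
    \<comment> \<open>The condition for the set \<open>range f\<close> bounds the limsup along its
      injective enumeration from below; \<open>limsup_reenumerate_le\<close> carries the bound to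
      \<open>f\<close>.\<close>
    define e where "e = from_nat_into (range f)"
    have e: "inj e" "range e = range f"
      using inf bij_betw_from_nat_into[of "range f"] unfolding e_def by (auto simp: bij_betw_def)
    have "\<exists>x\<in>X. \<top> \<tturnstile> ((check x :: ('v + nat, 'b) bname) \<in>\<^sub>b tau X q) \<rightarrow>\<^sub>b
        b_card_inter_eq (tau X q :: ('v + nat, 'b) bname) (check_set (range e)) omega_name"
      using \<open>?forces\<close> inf f unfolding e(2) by simp
    then obtain x where "x \<in> X" "q x \<le> limsup (\<lambda>n. q (e n))"
      using forces[OF _ e(1)] e(2) f by auto
    moreover have "limsup (\<lambda>n. q (e n)) \<le> limsup (\<lambda>n. q (f n))"
      using f by (intro limsup_reenumerate_le e) auto
    ultimately show "\<exists>x\<in>X. q x \<le> limsup (\<lambda>n. q (f n))" by (blast intro: order_trans)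
  qed
qed

section \<open>Minimal elements of the generated upward closed set\<close>

text \<open>An element of \<open>F\<close> below \<open>q x\<close> lies above some
  \<open>q y\<close>, and incomparability leaves only \<open>y = x\<close>. Conversely, minimality
  of \<open>q y\<close> turns \<open>q x \<le> q y\<close> into equality, which injectivity of
  \<open>q\<close> on \<open>X\<close> excludes.\<close>

lemma incomparable_iff_minimal_elements:
  fixes q :: "'v \<Rightarrow> 'b::order"
  assumes inj: "\<forall>x\<in>X. \<forall>y\<in>X. x \<noteq> y \<longrightarrow> q x \<noteq> q y" and F: "F = (\<Union>x\<in>X. {q x..})"
  shows "(\<forall>x\<in>X. \<forall>y\<in>X. x \<noteq> y \<longrightarrow> \<not> q x \<le> q y) \<longleftrightarrow> q ` X = minimal_elements F"
proof
  assume anti: "\<forall>x\<in>X. \<forall>y\<in>X. x \<noteq> y \<longrightarrow> \<not> q x \<le> q y"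
  show "q ` X = minimal_elements F"
  proof
    show "q ` X \<subseteq> minimal_elements F"
    proof
      fix m assume "m \<in> q ` X"
      then obtain x where x: "x \<in> X" "m = q x" by blast
      have "c = m" if c: "c \<in> F" "c \<le> m" for c
      proof -
        obtain y where y: "y \<in> X" "q y \<le> c" using c(1) unfolding F by auto
        then have "q y \<le> q x" using that(2) x(2) order_trans by blast
        then have "y = x" using anti x(1) y(1) by blast
        then show ?thesis using y(2) that(2) x(2) by simp
      qed
      then show "m \<in> minimal_elements F" using x F by (auto simp: minimal_elements_def)
    qed
    \<comment> \<open>A minimal element of \<open>F\<close> lies above some \<open>q x\<close>,
      itself in \<open>F\<close>, and so equals it.\<close>
    show "minimal_elements F \<subseteq> q ` X"
      unfolding minimal_elements_def F by fastforce
  qed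
next
  assume min: "q ` X = minimal_elements F"
  show "\<forall>x\<in>X. \<forall>y\<in>X. x \<noteq> y \<longrightarrow> \<not> q x \<le> q y"
  proof (intro ballI impI notI)
    fix x y assume *: "x \<in> X" "y \<in> X" "x \<noteq> y" "q x \<le> q y"
    then have "q y \<in> minimal_elements F" "q x \<in> F" using min F by auto
    then have "q x = q y" using *(4) by (simp add: minimal_elements_def)
    then show False using inj * by blast
  qed
qed

theorem theorem4p16:
  fixes X :: "'v::ground_sets set"
    and q :: "'v \<Rightarrow> 'b::{boolean_algebra, complete_lattice}"
    and \<tau> :: "('v + nat, 'b) bname"
    and F :: "'b set"
  assumes X_nonempty: "X \<noteq> {}"
    and \<tau>_def: "\<tau> = tau X q"
    and F_def: "F = (\<Union>x\<in>X. {q x..})"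
  shows "((\<forall>x\<in>X. \<forall>y\<in>X. x \<noteq> y \<longrightarrow> q x \<noteq> q y) \<longrightarrow>
      ((\<forall>x\<in>X. \<forall>y\<in>X. x \<noteq> y \<longrightarrow> \<not> q x \<le> q y \<and> \<not> q y \<le> q x) \<longleftrightarrow>
       (\<forall>x\<in>X. \<forall>y\<in>X. x \<noteq> y \<longrightarrow> (check x \<in>\<^sub>b \<tau>) \<sqinter> - (check y \<in>\<^sub>b \<tau>) > \<bottom>)) \<and>
      ((\<forall>x\<in>X. \<forall>y\<in>X. x \<noteq> y \<longrightarrow> (check x \<in>\<^sub>b \<tau>) \<sqinter> - (check y \<in>\<^sub>b \<tau>) > \<bottom>) \<longleftrightarrow>
       q ` X = minimal_elements F)) \<and>
      ((closedin up_topology F \<longleftrightarrow> up_limits F = F) \<and>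
      (up_limits F = F \<longleftrightarrow>
       (\<forall>f :: nat \<Rightarrow> 'v. range f \<subseteq> X \<longrightarrow> (\<exists>x\<in>X. q x \<le> limsup (\<lambda>n. q (f n))))) \<and>
      ((\<forall>f :: nat \<Rightarrow> 'v. range f \<subseteq> X \<longrightarrow> (\<exists>x\<in>X. q x \<le> limsup (\<lambda>n. q (f n)))) \<longleftrightarrow>
       (\<forall>f :: nat \<Rightarrow> 'v. range f \<subseteq> X \<and> (\<forall>x\<in>X. finite {n. f n = x}) \<longrightarrow>
          (\<exists>x\<in>X. q x \<le> limsup (\<lambda>n. q (f n))))) \<and>
      ((\<forall>f :: nat \<Rightarrow> 'v. range f \<subseteq> X \<and> (\<forall>x\<in>X. finite {n. f n = x}) \<longrightarrow>
          (\<exists>x\<in>X. q x \<le> limsup (\<lambda>n. q (f n)))) \<longleftrightarrow>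
       (\<forall>A. A \<subseteq> X \<and> infinite A \<and> countable A \<longrightarrow>
          (\<exists>x\<in>X. \<top> \<tturnstile> (check x \<in>\<^sub>b \<tau>) \<rightarrow>\<^sub>b b_card_inter_eq \<tau> (check_set A) omega_name))))"
proof (intro conjI impI)
  \<comment> \<open>The value is \<open>q x \<sqinter> - q y\<close>, which is zero exactly when
    \<open>q x \<le> q y\<close>.\<close>
  have "(check x \<in>\<^sub>b \<tau>) \<sqinter> - (check y \<in>\<^sub>b \<tau>) > \<bottom> \<longleftrightarrow> \<not> q x \<le> q y" if "x \<in> X" "y \<in> X" for x y
    using that by (simp add: \<tau>_def b_mem_tau inf_shunt flip: bot.not_eq_extremum)
  then have val: "(\<forall>x\<in>X. \<forall>y\<in>X. x \<noteq> y \<longrightarrow> (check x \<in>\<^sub>b \<tau>) \<sqinter> - (check y \<in>\<^sub>b \<tau>) > \<bottom>) \<longleftrightarrow>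
      (\<forall>x\<in>X. \<forall>y\<in>X. x \<noteq> y \<longrightarrow> \<not> q x \<le> q y)" by simp
  show "(\<forall>x\<in>X. \<forall>y\<in>X. x \<noteq> y \<longrightarrow> \<not> q x \<le> q y \<and> \<not> q y \<le> q x) \<longleftrightarrow>
      (\<forall>x\<in>X. \<forall>y\<in>X. x \<noteq> y \<longrightarrow> (check x \<in>\<^sub>b \<tau>) \<sqinter> - (check y \<in>\<^sub>b \<tau>) > \<bottom>)"
    \<comment> \<open>Since \<open>x\<close> and \<open>y\<close> range over both orders, the
      one-sided condition already says that they are incomparable.\<close>
    unfolding val by metis
  show "(\<forall>x\<in>X. \<forall>y\<in>X. x \<noteq> y \<longrightarrow> (check x \<in>\<^sub>b \<tau>) \<sqinter> - (check y \<in>\<^sub>b \<tau>) > \<bottom>) \<longleftrightarrow>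
      q ` X = minimal_elements F" if "\<forall>x\<in>X. \<forall>y\<in>X. x \<noteq> y \<longrightarrow> q x \<noteq> q y"
    unfolding val using that F_def by (rule incomparable_iff_minimal_elements)
  show "closedin up_topology F \<longleftrightarrow> up_limits F = F"
    unfolding F_def by (rule closedin_up_topology_iff_up_limits) (rule UN_atLeast_upward)
  show "up_limits F = F \<longleftrightarrow>
      (\<forall>f :: nat \<Rightarrow> 'v. range f \<subseteq> X \<longrightarrow> (\<exists>x\<in>X. q x \<le> limsup (\<lambda>n. q (f n))))"
    using F_def by (rule up_limits_eq_iff_limsup)
qed (simp_all only: \<tau>_def limsup_iff_finite_to_one finite_to_one_limsup_iff_forces)

end
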